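(* Let $p$ be an odd prime and $l,k$ positive integers. There exist groups $G_1$ and $G_2$ of rank two, neither isomorphic to $C_{p^l}*C_{p^k}$, such that for all $i\geq1$ $$G_1/\gamma_i(G_1)\cong G_2/\gamma_i(G_2)\cong (C_{p^l}*C_{p^k})/\gamma_i(C_{p^l}*C_{p^k}).$$ Moreover $G_1$ is residually nilpotent and $G_2$ is not residually nilpotent.
   Context: $C_m$ denotes the cyclic group of order $m$. Lower central series: $\gamma_1(G)=G$, $\gamma_k(G)=[G,\gamma_{k-1}(G)]$. Residually nilpotent means $\bigcap_k\gamma_k(G)=\{1\}$. Rank is the minimum size of a generating set. *)

theory Defs
  imports "HOL-Algebra.Algebra"
begin

definition comm_set :: "('a, 'b) monoid_scheme \<Rightarrow> 'a set \<Rightarrow> 'a set \<Rightarrow> 'a set" where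
  "comm_set G A B =
     {x \<otimes>\<^bsub>G\<^esub> y \<otimes>\<^bsub>G\<^esub> inv\<^bsub>G\<^esub> x \<otimes>\<^bsub>G\<^esub> inv\<^bsub>G\<^esub> y | x y. x \<in> A \<and> y \<in> B}"

(* lcs G n = gamma_(n+1)(G):  lcs G 0 = G,  lcs G (Suc n) = [G, lcs G n] *)
primrec lcs :: "('a, 'b) monoid_scheme \<Rightarrow> nat \<Rightarrow> 'a set" where
  "lcs G 0 = carrier G"
| "lcs G (Suc n) = generate G (comm_set G (carrier G) (lcs G n))"

(* gamma G i, for i >= 1, is the i-th term of the lower central series (gamma G 1 = G) *)
definition gamma :: "('a, 'b) monoid_scheme \<Rightarrow> nat \<Rightarrow> 'a set" where
  "gamma G i = lcs G (i - 1)"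

definition residually_nilpotent :: "('a, 'b) monoid_scheme \<Rightarrow> bool" where
  "residually_nilpotent G \<longleftrightarrow> (\<Inter>i\<in>{1..}. gamma G i) = {\<one>\<^bsub>G\<^esub>}"

definition group_rank :: "('a, 'b) monoid_scheme \<Rightarrow> nat" where
  "group_rank G = (LEAST n. \<exists>S. S \<subseteq> carrier G \<and> finite S \<and> card S = n
                              \<and> generate G S = carrier G)"

(* Elements are reduced words of letters (s, a): s = True means the letter a
   of C_m (= Z/mZ), s = False the letter a of C_n. *)

definition fp_ord :: "nat \<Rightarrow> nat \<Rightarrow> bool \<Rightarrow> nat" where
  "fp_ord m n s = (if s then m else n)"

definition fp_reduced :: "nat \<Rightarrow> nat \<Rightarrow> (bool \<times> nat) list \<Rightarrow> bool" where
  "fp_reduced m n w \<longleftrightarrow>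
     (\<forall>(s, a) \<in> set w. 0 < a \<and> a < fp_ord m n s) \<and>
     (\<forall>i. Suc i < length w \<longrightarrow> fst (w ! i) \<noteq> fst (w ! Suc i))"

fun fp_cons :: "nat \<Rightarrow> nat \<Rightarrow> bool \<times> nat \<Rightarrow> (bool \<times> nat) list \<Rightarrow> (bool \<times> nat) list" where
  "fp_cons m n (s, a) [] =
     (if a mod fp_ord m n s = 0 then [] else [(s, a mod fp_ord m n s)])"
| "fp_cons m n (s, a) ((t, b) # w) =
     (if s = t then
        (let c = (a + b) mod fp_ord m n s in if c = 0 then w else (s, c) # w)
      else if a mod fp_ord m n s = 0 then (t, b) # w
      else (s, a mod fp_ord m n s) # (t, b) # w)"

definition free_prod_cyclic :: "nat \<Rightarrow> nat \<Rightarrow> (bool \<times> nat) list monoid" where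
  "free_prod_cyclic m n =
     \<lparr>carrier = {w. fp_reduced m n w},
      monoid.mult = (\<lambda>w1 w2. foldr (fp_cons m n) w1 w2),
      one = []\<rparr>"

end

theory Submission
  imports Defs "HOL-Library.Countable_Set" "HOL-Computational_Algebra.Polynomial"
begin

text \<open>
  Let \<open>F\<close> be the free product, with standard generators \<open>a\<close> and \<open>b\<close>.

  In a nilpotent group the equation \<open>y y b a = a y\<close> has a solution \<open>y\<close>, found by successive approximation
  along the lower central series, and \<open>a\<close>, \<open>b\<close> generate the same subgroup as \<open>a\<close>, \<open>y\<close>. Hence a group
  generated by \<open>a\<close>, \<open>y\<close> in which \<open>a\<close> and \<open>b = y\<inverse> y\<inverse> a y a\<inverse>\<close> satisfy the relations of \<open>F\<close>, and which maps
  onto all nilpotent quotients of \<open>F\<close>, has the same nilpotent quotients as \<open>F\<close>. The group \<open>G\<^sub>1\<close> is the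
  diagonal subgroup generated by such pairs in the product of all \<open>F / \<gamma>\<^sub>N\<close> and of groups of triangular matrices
  over \<open>\<int>[x] / (x ^ p - 1)\<close>; these matrices are congruent to \<open>1\<close> modulo \<open>x - 1\<close>, so \<open>G\<^sub>1\<close> is residually nilpotent.
  The group \<open>G\<^sub>2\<close> is generated in the product of \<open>F\<close> with finite affine groups over \<open>\<int> / (2 ^ p - 1)\<close>, in one of
  which \<open>a\<close> acts as \<open>v \<mapsto> 2 v\<close> and \<open>b\<close> as a translation; there \<open>c = b ^ (p ^ k)\<close> is not trivial, and \<open>c = [a, c]\<close> lies
  in every term of the lower central series.

  Both groups have, by \<open>x \<mapsto> 2\<close> for \<open>G\<^sub>1\<close>, non-abelian affine quotients over \<open>\<int> / (2 ^ p - 1)\<close> with linear parts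
  \<open>2 ^ e\<close> and \<open>2 ^ (i e - f)\<close> (\<open>0 < i < p\<close>), where \<open>e\<close>, \<open>f\<close> are the exponent sums of the two generators.
  If two elements of \<open>p\<close>-power order generated the group, then in one of these quotients one of
  them would have trivial linear part, hence be a translation of order prime to \<open>p\<close>, hence trivial, and the
  quotient would be cyclic. As \<open>F\<close> is generated by two such elements, neither group is isomorphic to \<open>F\<close>.
\<close>

section \<open>Free products of two cyclic groups\<close>

lemma fp_reduced_Nil [simp]: "fp_reduced m n []"
  by (simp add: fp_reduced_def)

lemma fp_reduced_Cons:
  "fp_reduced m n ((s, a) # w) \<longleftrightarrow>
     0 < a \<and> a < fp_ord m n s \<and> fp_reduced m n w \<and> (w \<noteq> [] \<longrightarrow> fst (hd w) \<noteq> s)"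
proof -
  have "(\<forall>i. Suc i < length ((s, a) # w) \<longrightarrow> fst (((s, a) # w) ! i) \<noteq> fst (((s, a) # w) ! Suc i)) \<longleftrightarrow>
      (w \<noteq> [] \<longrightarrow> fst (hd w) \<noteq> s) \<and> (\<forall>i. Suc i < length w \<longrightarrow> fst (w ! i) \<noteq> fst (w ! Suc i))"
    (is "?L \<longleftrightarrow> ?R")
  proof
    assume L: ?L
    show ?R
    proof (intro conjI impI allI)
      assume "w \<noteq> []"
      then show "fst (hd w) \<noteq> s" using L[rule_format, of 0] by (auto simp: hd_conv_nth)
    next
      fix i assume "Suc i < length w"
      then show "fst (w ! i) \<noteq> fst (w ! Suc i)" using L[rule_format, of "Suc i"] by simp
    qed
  next
    assume R: ?R
    show ?L
    proof (intro allI impI)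
      fix i assume "Suc i < length ((s, a) # w)"
      then show "fst (((s, a) # w) ! i) \<noteq> fst (((s, a) # w) ! Suc i)"
        using R by (cases i) (auto simp: hd_conv_nth)
    qed
  qed
  then show ?thesis
    unfolding fp_reduced_def by auto
qed

lemma fp_cons_cong:
  "a mod fp_ord m n s = a' mod fp_ord m n s \<Longrightarrow> fp_cons m n (s, a) w = fp_cons m n (s, a') w"
proof (cases w)
  case (Cons x w')
  assume eq: "a mod fp_ord m n s = a' mod fp_ord m n s"
  obtain t b where w: "w = (t, b) # w'" using Cons by (cases x) auto
  show ?thesis
  proof (cases "s = t")
    case True
    then have "(a + b) mod fp_ord m n t = (a' + b) mod fp_ord m n t"
      using eq mod_add_cong by blast
    then show ?thesis using w True by (simp add: Let_def)
  qed (use eq w in simp)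
qed simp

lemma fp_cons_reduced:
  assumes "\<And>s. 0 < fp_ord m n s" "fp_reduced m n w"
  shows "fp_reduced m n (fp_cons m n (s, a) w)"
proof (cases w)
  case Nil then show ?thesis using assms by (auto simp: fp_reduced_Cons)
next
  case (Cons x w')
  then obtain t b where "w = (t, b) # w'" by (cases x) auto
  then show ?thesis using assms by (auto simp: fp_reduced_Cons Let_def)
qed

lemma fp_cons_zero:
  assumes "fp_reduced m n w" "a mod fp_ord m n s = 0"
  shows "fp_cons m n (s, a) w = w"
proof (cases w)
  case Nil then show ?thesis using assms by auto
next
  case (Cons x w')
  then obtain t b where w: "w = (t, b) # w'" by (cases x) auto
  show ?thesis
  proof (cases "s = t")
    case True
    then have "(a + b) mod fp_ord m n t = b" "0 < b"
      using assms w mod_add_left_eq[of a "fp_ord m n t" b] by (simp_all add: fp_reduced_Cons)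
    then show ?thesis using w True by (simp add: Let_def)
  qed (use assms w in simp)
qed

text \<open>Each cyclic factor acts on the set of reduced words by prepending letters, as in van der
  Waerden's construction. Associativity of the product rests on this.\<close>

lemma fp_cons_add:
  assumes "fp_reduced m n w"
  shows "fp_cons m n (s, a) (fp_cons m n (s, b) w) = fp_cons m n (s, a + b) w"
proof (cases w)
  case Nil
  then show ?thesis
    using mod_add_right_eq[of a b "fp_ord m n s"] by (auto simp: Let_def)
next
  case (Cons x w')
  then obtain t c where w: "w = (t, c) # w'" by (cases x) auto
  \<comment> \<open>When the head of \<open>w\<close> cancels, the exposed word \<open>w'\<close>
    starts with a letter of the other factor, so no second merging takes place.\<close>
  have z: "fp_cons m n (t, a) w' = (if a mod fp_ord m n t = 0 then w' else (t, a mod fp_ord m n t) # w')"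
    using assms w by (cases w') (auto simp: fp_reduced_Cons)
  define N where "N = fp_ord m n t"
  have e1: "(a + (b + c) mod N) mod N = (a + b + c) mod N" by (simp add: mod_add_right_eq add.assoc)
  show ?thesis
  proof (cases "s = t")
    case True
    show ?thesis
    proof (cases "(b + c) mod N = 0")
      case zero: True
      then have "a mod N = (a + b + c) mod N" using e1 by simp
      then show ?thesis using True w z zero by (simp add: Let_def N_def)
    next
      case False
      then show ?thesis using True w e1 by (simp add: Let_def N_def)
    qed
  next
    case False
    define N' where "N' = fp_ord m n s"
    have e2: "(a + b mod N') mod N' = (a + b) mod N'" by (simp add: mod_add_right_eq)
    show ?thesis
    proof (cases "b mod N' = 0")
      case True
      then have "a mod N' = (a + b) mod N'" using e2 by simp
      then show ?thesis using False w True by (simp add: Let_def N'_def)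
    next
      case F2: False
      then show ?thesis using False w e2 by (simp add: Let_def N'_def)
    qed
  qed
qed

lemma foldr_fp_cons_reduced:
  assumes "\<And>s. 0 < fp_ord m n s" "fp_reduced m n v"
  shows "fp_reduced m n (foldr (fp_cons m n) w v)"
proof (induction w)
  case (Cons x w) then show ?case using assms by (cases x) (simp add: fp_cons_reduced)
qed (use assms in simp)

text \<open>Words are read as operators on reduced words: merging or cancelling at the head of
  \<open>w\<close> does not change its operator. Iterating over the letters of a second word gives
  associativity.\<close>

lemma foldr_fp_cons:
  assumes pos: "\<And>s. 0 < fp_ord m n s" and v: "fp_reduced m n v"
  shows "foldr (fp_cons m n) (fp_cons m n (s, a) w) v = fp_cons m n (s, a) (foldr (fp_cons m n) w v)"
proof (cases w)
  case Nil
  then show ?thesis using fp_cons_zero[OF v]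
    by (auto intro: fp_cons_cong)
next
  case (Cons x w')
  then obtain t b where w: "w = (t, b) # w'" by (cases x) auto
  have r: "fp_reduced m n (foldr (fp_cons m n) w' v)" by (rule foldr_fp_cons_reduced[OF pos v])
  have r': "fp_reduced m n (foldr (fp_cons m n) w v)" by (rule foldr_fp_cons_reduced[OF pos v])
  show ?thesis
  proof (cases "s = t")
    case True
    have "fp_cons m n (s, a) (foldr (fp_cons m n) w v) = fp_cons m n (s, a + b) (foldr (fp_cons m n) w' v)"
      using w True fp_cons_add[OF r] by simp
    also have "\<dots> = foldr (fp_cons m n) (fp_cons m n (s, a) w) v"
      using w True fp_cons_zero[OF r, of "a + b" s] fp_cons_cong[of "a + b" m n s "(a + b) mod fp_ord m n s"]
      by (auto simp: Let_def)
    finally show ?thesis by simp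
  next
    case False
    then show ?thesis using w fp_cons_zero[OF r', of a s] fp_cons_cong[of "a" m n s "a mod fp_ord m n s"]
      by (auto simp: Let_def)
  qed
qed

lemma foldr_fp_cons_foldr:
  assumes pos: "\<And>s. 0 < fp_ord m n s" and v: "fp_reduced m n v"
  shows "foldr (fp_cons m n) (foldr (fp_cons m n) u w) v
       = foldr (fp_cons m n) u (foldr (fp_cons m n) w v)"
proof (induction u)
  case (Cons x u) then show ?case using foldr_fp_cons[OF pos v] by (cases x) simp
qed simp

lemma foldr_fp_cons_Nil: "fp_reduced m n w \<Longrightarrow> foldr (fp_cons m n) w [] = w"
proof (induction w)
  case (Cons x w)
  obtain s a where x: "x = (s, a)" by (cases x)
  have "fp_cons m n (s, a) w = (s, a) # w"
    using Cons.prems x by (cases w) (auto simp: fp_reduced_Cons)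
  then show ?case using Cons x by (simp add: fp_reduced_Cons)
qed simp

lemma (in group) subgroup_nat_pow_mem:
  "subgroup H G \<Longrightarrow> h \<in> H \<Longrightarrow> h [^] (k::nat) \<in> H"
  by (induction k) (auto intro: subgroup.one_closed subgroup.m_closed)

section \<open>The free product as a group: generators and universal property\<close>

locale free_prod =
  fixes m n :: nat
  assumes m2: "2 \<le> m" and n2: "2 \<le> n"
begin

abbreviation "\<F> \<equiv> free_prod_cyclic m n"
abbreviation "gen1 \<equiv> [(True, 1::nat)]"
abbreviation "gen2 \<equiv> [(False, 1::nat)]"

lemma ord_ge_2: "2 \<le> fp_ord m n s"
  using m2 n2 by (simp add: fp_ord_def)

lemma ord_pos: "0 < fp_ord m n s"
  using ord_ge_2[of s] by simp

lemma carrier_F: "w \<in> carrier \<F> \<longleftrightarrow> fp_reduced m n w"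
  by (simp add: free_prod_cyclic_def)

lemma mult_F: "v \<otimes>\<^bsub>\<F>\<^esub> w = foldr (fp_cons m n) v w"
  by (simp add: free_prod_cyclic_def)

lemma one_F: "\<one>\<^bsub>\<F>\<^esub> = []"
  by (simp add: free_prod_cyclic_def)

lemma monoid_F: "Group.monoid \<F>"
  by (rule monoidI)
     (auto simp: carrier_F mult_F one_F foldr_fp_cons_reduced[OF ord_pos]
       foldr_fp_cons_foldr[OF ord_pos] foldr_fp_cons_Nil)

lemma letter_in_F: "0 < a \<Longrightarrow> a < fp_ord m n s \<Longrightarrow> [(s, a)] \<in> carrier \<F>"
  by (simp add: carrier_F fp_reduced_Cons)

lemma Cons_eq_mult: "(s, a) # w \<in> carrier \<F> \<Longrightarrow> (s, a) # w = [(s, a)] \<otimes>\<^bsub>\<F>\<^esub> w"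
  by (cases w) (auto simp: carrier_F mult_F fp_reduced_Cons)

lemma group_F: "group \<F>"
proof -
  interpret Group.monoid \<F> by (rule monoid_F)
  have "w \<in> Units \<F>" if "w \<in> carrier \<F>" for w
    using that
  proof (induction w)
    case Nil then show ?case by (metis one_F Units_one_closed)
  next
    case (Cons x w)
    obtain s a where x: "x = (s, a)" by (cases x)
    have a: "0 < a" "a < fp_ord m n s" and w: "w \<in> carrier \<F>"
      using Cons.prems x by (auto simp: carrier_F fp_reduced_Cons)
    have "[(s, a)] \<in> Units \<F>"
      unfolding Units_def using a letter_in_F[of a s] letter_in_F[of "fp_ord m n s - a" s]
      by (auto simp: mult_F one_F intro!: bexI[of _ "[(s, fp_ord m n s - a)]"])
    then have "[(s, a)] \<otimes>\<^bsub>\<F>\<^esub> w \<in> Units \<F>" using Cons.IH[OF w] by (rule Units_m_closed)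
    then show ?case using Cons_eq_mult Cons.prems x by simp
  qed
  then show ?thesis by unfold_locales blast
qed

text \<open>Writing the power with \<open>fp_cons\<close> lets it collapse to the empty word when
  the order divides \<open>k\<close>; the relations in \<open>gen_pow\<close> are read off from
  this.\<close>

lemma pow_letter:
  "[(s, 1)] [^]\<^bsub>\<F>\<^esub> k = fp_cons m n (s, k) []"
proof -
  interpret group \<F> by (rule group_F)
  have one: "fp_cons m n (s, 1) [] = [(s, 1)]"
    using ord_ge_2[of s] by simp
  show ?thesis
  proof (induction k)
    case (Suc k)
    have "fp_reduced m n [(s, 1)]"
      using ord_ge_2[of s] by (simp add: fp_reduced_Cons)
    then have "fp_cons m n (s, k) [] \<otimes>\<^bsub>\<F>\<^esub> [(s, 1)] = fp_cons m n (s, k) [(s, 1)]"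
      by (simp only: mult_F foldr_fp_cons[OF ord_pos] foldr.simps id_apply)
    also have "\<dots> = fp_cons m n (s, k + 1) []"
      using fp_cons_add[OF fp_reduced_Nil, of m n s k 1] one by simp
    finally show ?case using Suc by simp
  qed (simp add: one_F)
qed

lemma gen_in_F: "gen1 \<in> carrier \<F>" "gen2 \<in> carrier \<F>"
  using letter_in_F[of 1] ord_ge_2 by (simp_all add: Suc_le_lessD numeral_2_eq_2)

lemma gen_pow: "gen1 [^]\<^bsub>\<F>\<^esub> m = \<one>\<^bsub>\<F>\<^esub>" "gen2 [^]\<^bsub>\<F>\<^esub> n = \<one>\<^bsub>\<F>\<^esub>"
  by (simp_all only: pow_letter one_F) (simp_all add: fp_ord_def)

lemma generate_F: "generate \<F> {gen1, gen2} = carrier \<F>"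
proof
  interpret group \<F> by (rule group_F)
  show "generate \<F> {gen1, gen2} \<subseteq> carrier \<F>"
    using gen_in_F by (intro generate_incl) auto
  interpret H: subgroup "generate \<F> {gen1, gen2}" \<F>
    using gen_in_F by (intro generate_is_subgroup) auto
  show "carrier \<F> \<subseteq> generate \<F> {gen1, gen2}"
  proof
    fix w assume "w \<in> carrier \<F>"
    then show "w \<in> generate \<F> {gen1, gen2}"
    proof (induction w)
      case Nil then show ?case using H.one_closed one_F by metis
    next
      case (Cons x w)
      obtain s a where x: "x = (s, a)" by (cases x)
      have a: "0 < a" "a < fp_ord m n s" and w: "w \<in> carrier \<F>"
        using Cons.prems x by (auto simp: carrier_F fp_reduced_Cons)
      have "[(s, 1)] \<in> generate \<F> {gen1, gen2}"
        by (cases s) (auto intro: generate.incl)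
      then have "[(s, 1)] [^]\<^bsub>\<F>\<^esub> a \<in> generate \<F> {gen1, gen2}"
        using gen_in_F by (intro subgroup_nat_pow_mem H.subgroup_axioms)
      then have "[(s, a)] \<in> generate \<F> {gen1, gen2}"
        using a unfolding pow_letter by simp
      then show ?case using Cons.IH[OF w] Cons_eq_mult[of s a w] Cons.prems x H.m_closed by simp
    qed
  qed
qed

text \<open>Universal property. Evaluating words in \<open>G\<close> is compatible with merging
  letters because a power of \<open>g s\<close> depends only on the exponent modulo
  \<open>fp_ord m n s\<close>.\<close>

lemma hom_from_F:
  assumes "group G" and \<alpha>: "\<alpha> \<in> carrier G" "\<alpha> [^]\<^bsub>G\<^esub> m = \<one>\<^bsub>G\<^esub>"
    and \<beta>: "\<beta> \<in> carrier G" "\<beta> [^]\<^bsub>G\<^esub> n = \<one>\<^bsub>G\<^esub>"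
  obtains \<phi> where "\<phi> \<in> hom \<F> G" "\<phi> gen1 = \<alpha>" "\<phi> gen2 = \<beta>"
proof -
  interpret G: group G by fact
  define g where "g s = (if s then \<alpha> else \<beta>)" for s
  define \<phi> where "\<phi> = (\<lambda>w. foldr (\<lambda>(s, a) h. g s [^]\<^bsub>G\<^esub> (a::nat) \<otimes>\<^bsub>G\<^esub> h) w \<one>\<^bsub>G\<^esub>)"
  have \<phi>_Nil: "\<phi> [] = \<one>\<^bsub>G\<^esub>" by (simp add: \<phi>_def)
  have \<phi>_Cons: "\<phi> ((s, a) # w) = g s [^]\<^bsub>G\<^esub> a \<otimes>\<^bsub>G\<^esub> \<phi> w" for s a w
    by (simp add: \<phi>_def)
  have g: "g s \<in> carrier G" for s using \<alpha> \<beta> by (simp add: g_def)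
  have g_pow: "g s [^]\<^bsub>G\<^esub> fp_ord m n s = \<one>\<^bsub>G\<^esub>" for s using \<alpha> \<beta> by (simp add: g_def fp_ord_def)
  have g_mod: "g s [^]\<^bsub>G\<^esub> (a mod fp_ord m n s) = g s [^]\<^bsub>G\<^esub> a" for s and a :: nat
  proof -
    have "g s [^]\<^bsub>G\<^esub> a = g s [^]\<^bsub>G\<^esub> (fp_ord m n s * (a div fp_ord m n s) + a mod fp_ord m n s)"
      by simp
    also have "\<dots> = (g s [^]\<^bsub>G\<^esub> fp_ord m n s) [^]\<^bsub>G\<^esub> (a div fp_ord m n s) \<otimes>\<^bsub>G\<^esub> g s [^]\<^bsub>G\<^esub> (a mod fp_ord m n s)"
      using g by (simp only: G.nat_pow_mult[symmetric] G.nat_pow_pow)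
    finally show ?thesis using g by (simp add: g_pow)
  qed
  have \<phi>: "\<phi> w \<in> carrier G" for w
    by (induction w) (auto simp: \<phi>_Nil \<phi>_Cons g)
  have cons: "\<phi> (fp_cons m n (s, a) w) = g s [^]\<^bsub>G\<^esub> a \<otimes>\<^bsub>G\<^esub> \<phi> w" for s a w
  proof (cases w)
    case Nil
    then show ?thesis using g_mod[of s a] g by (auto simp: \<phi>_Nil \<phi>_Cons)
  next
    case (Cons x w')
    then obtain t b where w: "w = (t, b) # w'" by (cases x) auto
    show ?thesis
    proof (cases "s = t")
      case True
      have "g s [^]\<^bsub>G\<^esub> a \<otimes>\<^bsub>G\<^esub> \<phi> w = g s [^]\<^bsub>G\<^esub> (a + b) \<otimes>\<^bsub>G\<^esub> \<phi> w'"
        using w True g \<phi> by (simp add: \<phi>_Cons G.m_assoc[symmetric] G.nat_pow_mult)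
      also have "\<dots> = g s [^]\<^bsub>G\<^esub> ((a + b) mod fp_ord m n s) \<otimes>\<^bsub>G\<^esub> \<phi> w'"
        by (simp add: g_mod)
      finally show ?thesis using w True g \<phi>
        by (simp add: Let_def \<phi>_Cons)
    next
      case False
      then show ?thesis using w g_mod[of s a] g \<phi> by (auto simp: \<phi>_Cons)
    qed
  qed
  have "\<phi> (foldr (fp_cons m n) v w) = \<phi> v \<otimes>\<^bsub>G\<^esub> \<phi> w" for v w
    by (induction v) (auto simp: cons \<phi>_Nil \<phi>_Cons \<phi> g G.m_assoc)
  then have "\<phi> \<in> hom \<F> G"
    by (auto simp: hom_def mult_F \<phi>)
  moreover have "\<phi> gen1 = \<alpha>" "\<phi> gen2 = \<beta>"
    using \<alpha> \<beta> by (simp_all add: \<phi>_Cons \<phi>_Nil g_def)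
  ultimately show ?thesis by (rule that)
qed

end

section \<open>Lower central series\<close>

lemma (in group) mult_inv_mult:
  "w \<in> carrier G \<Longrightarrow> v \<in> carrier G \<Longrightarrow> w \<otimes> (inv w \<otimes> v) = v"
  by (simp add: m_assoc[symmetric])

text \<open>A conjugate of a commutator is the commutator of the conjugates, so normality of one
  term makes the generating set of the next one invariant under conjugation.\<close>

lemma (in group) lcs_normal: "lcs G n \<lhd> G"
proof (induction n)
  case 0
  show ?case by (simp add: normal_inv_iff subgroup_self)
next
  case (Suc n)
  interpret N: normal "lcs G n" G by fact
  show ?case
    unfolding lcs.simps
  proof (rule normal_generateI)
    show "comm_set G (carrier G) (lcs G n) \<subseteq> carrier G"
      by (auto simp: comm_set_def)
  next
    fix h g assume "h \<in> comm_set G (carrier G) (lcs G n)" and g: "g \<in> carrier G"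
    then obtain x y where x: "x \<in> carrier G" and y: "y \<in> lcs G n"
      and h: "h = x \<otimes> y \<otimes> inv x \<otimes> inv y" by (auto simp: comm_set_def)
    have y': "y \<in> carrier G" using y by (rule N.mem_carrier)
    have "g \<otimes> h \<otimes> inv g = (g \<otimes> x \<otimes> inv g) \<otimes> (g \<otimes> y \<otimes> inv g) \<otimes> inv (g \<otimes> x \<otimes> inv g) \<otimes> inv (g \<otimes> y \<otimes> inv g)"
      using x y' g by (simp add: h inv_mult_group m_assoc inv_solve_left) (simp add: m_assoc[symmetric])
    moreover have "g \<otimes> y \<otimes> inv g \<in> lcs G n" using N.inv_op_closed2[OF g y] .
    ultimately show "g \<otimes> h \<otimes> inv g \<in> comm_set G (carrier G) (lcs G n)"
      using x g by (auto simp: comm_set_def)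
  qed
qed

lemma (in group) lcs_commutator:
  "x \<in> carrier G \<Longrightarrow> y \<in> lcs G n \<Longrightarrow> x \<otimes> y \<otimes> inv x \<otimes> inv y \<in> lcs G (Suc n)"
  by (auto simp: comm_set_def intro!: generate.incl)

lemma (in group_hom) lcs_image:
  "h ` lcs G n \<subseteq> lcs H n"
proof (induction n)
  case (Suc n)
  interpret N: normal "lcs G n" G by (rule G.lcs_normal)
  have "comm_set G (carrier G) (lcs G n) \<subseteq> carrier G"
    by (auto simp: comm_set_def)
  then have "h ` lcs G (Suc n) = generate H (h ` comm_set G (carrier G) (lcs G n))"
    by (simp add: generate_img)
  also have "h ` comm_set G (carrier G) (lcs G n) \<subseteq> comm_set H (carrier H) (lcs H n)"
    using Suc by (fastforce simp: comm_set_def)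
  then have "generate H (h ` comm_set G (carrier G) (lcs G n)) \<subseteq> lcs H (Suc n)"
    by (simp add: H.mono_generate)
  finally show ?case .
qed auto

lemma (in group_hom) lcs_image_surj:
  assumes "h ` carrier G = carrier H"
  shows "h ` lcs G n = lcs H n"
proof (induction n)
  case (Suc n)
  interpret N: normal "lcs G n" G by (rule G.lcs_normal)
  have "comm_set G (carrier G) (lcs G n) \<subseteq> carrier G"
    by (auto simp: comm_set_def)
  then have "h ` lcs G (Suc n) = generate H (h ` comm_set G (carrier G) (lcs G n))"
    by (simp add: generate_img)
  also have "h ` comm_set G (carrier G) (lcs G n) = comm_set H (h ` carrier G) (h ` lcs G n)"
    by (fastforce simp: comm_set_def image_iff)
  also have "\<dots> = comm_set H (carrier H) (lcs H n)"
    using Suc assms by simp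
  finally show ?case by simp
qed (use assms in auto)

lemma (in group) Mod_hom: 
  assumes "N \<lhd> G"
  shows "group_hom G (G Mod N) (\<lambda>x. N #> x)"
  using assms by (intro group_hom.intro group_hom_axioms.intro group_axioms normal.factorgroup_is_group normal.r_coset_hom_Mod)

text \<open>Because of the index shift in \<open>lcs\<close>, this quotient is nilpotent of class at
  most \<open>n\<close>: its series is the image of that of \<open>G\<close> and is trivial from
  index \<open>n\<close> on.\<close>

lemma (in group) lcs_Mod: "lcs (G Mod lcs G n) n = {\<one>\<^bsub>G Mod lcs G n\<^esub>}"
proof -
  interpret N: normal "lcs G n" G by (rule lcs_normal)
  interpret h: group_hom G "G Mod lcs G n" "\<lambda>x. lcs G n #> x" by (intro Mod_hom lcs_normal)
  have "(\<lambda>x. lcs G n #> x) ` carrier G = carrier (G Mod lcs G n)"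
    by (auto simp: FactGroup_def RCOSETS_def)
  from h.lcs_image_surj[OF this, of n]
  have "lcs (G Mod lcs G n) n = (\<lambda>x. lcs G n #> x) ` lcs G n" by simp
  also have "\<dots> = {lcs G n}"
    using N.rcos_const[OF group_axioms] N.one_closed by (auto intro!: image_eqI[of _ _ \<one>])
  finally show ?thesis by simp
qed

section \<open>The equation y y b a = a y along the lower central series\<close>

lemma (in group) Mod_eq_one_iff:
  assumes "subgroup N G" "x \<in> carrier G"
  shows "N #> x = \<one>\<^bsub>G Mod N\<^esub> \<longleftrightarrow> x \<in> N"
  using assms coset_join1[of N x] coset_join2[of x N] subgroup.subset[of N G] by auto

text \<open>Errors that lie in one term of the series become central modulo the next. This is what
  drives both approximation arguments below.\<close>

lemma (in group) lcs_central:
  assumes "x \<in> carrier G" "z \<in> lcs G N"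
  shows "(lcs G (Suc N) #> z) \<otimes>\<^bsub>G Mod lcs G (Suc N)\<^esub> (lcs G (Suc N) #> x)
       = (lcs G (Suc N) #> x) \<otimes>\<^bsub>G Mod lcs G (Suc N)\<^esub> (lcs G (Suc N) #> z)"
proof -
  interpret N: normal "lcs G N" G by (rule lcs_normal)
  interpret N': normal "lcs G (Suc N)" G by (rule lcs_normal)
  interpret c: group_hom G "G Mod lcs G (Suc N)" "\<lambda>x. lcs G (Suc N) #> x" by (intro Mod_hom lcs_normal)
  have z: "z \<in> carrier G" using assms(2) by (rule N.mem_carrier)
  have "x \<otimes> z \<otimes> inv (z \<otimes> x) \<in> lcs G (Suc N)"
    using lcs_commutator[OF assms] assms(1) z by (simp add: inv_mult_group m_assoc)
  then have "lcs G (Suc N) #> (x \<otimes> z \<otimes> inv (z \<otimes> x)) = \<one>\<^bsub>G Mod lcs G (Suc N)\<^esub>"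
    using assms(1) z Mod_eq_one_iff[OF N'.subgroup_axioms] by simp
  then have "lcs G (Suc N) #> (x \<otimes> z) = lcs G (Suc N) #> (z \<otimes> x)"
    using assms(1) z by (metis c.H.inv_equality c.H.inv_inv c.hom_closed c.hom_inv c.hom_mult inv_closed m_closed)
  then show ?thesis using assms(1) z by (simp only: c.hom_mult)
qed

text \<open>Successive approximation: the unknown has exponent sum 2 on the left and 1 on the right,
  so a central error can be absorbed into \<open>y\<close> without extracting roots.\<close>

lemma (in group) solve_mod_lcs:
  assumes a: "a \<in> carrier G" and b: "b \<in> carrier G"
  shows "\<exists>y\<in>carrier G. inv (y \<otimes> y \<otimes> b \<otimes> a) \<otimes> (a \<otimes> y) \<in> lcs G N"
proof (induction N)
  case 0
  then show ?case using a b by (intro bexI[of _ \<one>]) auto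
next
  case (Suc N)
  then obtain y where y: "y \<in> carrier G" and e: "inv (y \<otimes> y \<otimes> b \<otimes> a) \<otimes> (a \<otimes> y) \<in> lcs G N" by blast
  define \<epsilon> where "\<epsilon> = inv (y \<otimes> y \<otimes> b \<otimes> a) \<otimes> (a \<otimes> y)"
  have \<epsilon>: "\<epsilon> \<in> carrier G" using a b y by (simp add: \<epsilon>_def)
  have ay: "a \<otimes> y = y \<otimes> y \<otimes> b \<otimes> a \<otimes> \<epsilon>"
    unfolding \<epsilon>_def using a b y by (intro mult_inv_mult[symmetric]) simp_all
  define K where "K = lcs G (Suc N)"
  interpret K: normal K G unfolding K_def by (rule lcs_normal)
  interpret c: group_hom G "G Mod K" "\<lambda>x. K #> x" by (intro Mod_hom K.normal_axioms)
  define c where "c x = K #> x" for x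
  have c_mult: "c (u \<otimes> v) = c u \<otimes>\<^bsub>G Mod K\<^esub> c v" if "u \<in> carrier G" "v \<in> carrier G" for u v
    unfolding c_def using that by (rule c.hom_mult)
  have c_closed: "c u \<in> carrier (G Mod K)" if "u \<in> carrier G" for u
    unfolding c_def using that by (rule c.hom_closed)
  have c_quot: "c (inv u \<otimes> v) = \<one>\<^bsub>G Mod K\<^esub>" if "c u = c v" "u \<in> carrier G" "v \<in> carrier G" for u v
    using c.hom_mult[OF inv_closed[OF that(2)] that(3)] c.hom_inv[OF that(2)] that c.H.l_inv[OF c.hom_closed[OF that(2)]]
    unfolding c_def by metis
  have comm: "c \<epsilon> \<otimes>\<^bsub>G Mod K\<^esub> c u = c u \<otimes>\<^bsub>G Mod K\<^esub> c \<epsilon>" if "u \<in> carrier G" for u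
    unfolding c_def K_def using that e by (intro lcs_central) (simp_all add: \<epsilon>_def)
  have comm': "c \<epsilon> \<otimes>\<^bsub>G Mod K\<^esub> (c u \<otimes>\<^bsub>G Mod K\<^esub> w) = c u \<otimes>\<^bsub>G Mod K\<^esub> (c \<epsilon> \<otimes>\<^bsub>G Mod K\<^esub> w)"
    if "u \<in> carrier G" "w \<in> carrier (G Mod K)" for u w
    using comm[OF that(1)] that \<epsilon> by (simp add: c.H.m_assoc[symmetric] c_closed del: mult_FactGroup)
  \<comment> \<open>Modulo \<open>K\<close> the error is central, so passing to \<open>y'\<close>
    multiplies the left side by \<epsilon>^2 and the right side by \<epsilon>. As the right side was
    already the left side times \<epsilon>, the two now agree.\<close>
  define y' where "y' = y \<otimes> \<epsilon>"
  have y': "y' \<in> carrier G" using y \<epsilon> by (simp add: y'_def)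
  have "c (y' \<otimes> y' \<otimes> b \<otimes> a) = c (y \<otimes> y \<otimes> b \<otimes> a \<otimes> \<epsilon>) \<otimes>\<^bsub>G Mod K\<^esub> c \<epsilon>"
    using a b y \<epsilon>
    by (simp add: y'_def c_mult c_closed c.H.m_assoc comm[OF a] comm[OF b] comm[OF y]
        comm'[OF a] comm'[OF b] comm'[OF y] del: mult_FactGroup)
  also have "\<dots> = c (a \<otimes> y')"
    using a b y \<epsilon> unfolding ay[symmetric] by (simp add: y'_def c_mult c_closed c.H.m_assoc del: mult_FactGroup)
  finally have "c (inv (y' \<otimes> y' \<otimes> b \<otimes> a) \<otimes> (a \<otimes> y')) = \<one>\<^bsub>G Mod K\<^esub>"
    using a b y' by (intro c_quot) simp_all
  then have "inv (y' \<otimes> y' \<otimes> b \<otimes> a) \<otimes> (a \<otimes> y') \<in> K"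
    using Mod_eq_one_iff[OF K.subgroup_axioms, of "inv (y' \<otimes> y' \<otimes> b \<otimes> a) \<otimes> (a \<otimes> y')"] a b y'
    unfolding c_def by simp
  then show ?case
    using y' unfolding K_def by blast
qed

text \<open>Solved for its first factor, the relation reads y = (inv y a y) inv a inv b. On the
  right \<open>y\<close> enters only by conjugation, so an approximation \<open>h\<close> modulo one
  term yields a better one modulo the next.\<close>

lemma (in group) root_in_generate_mod_lcs:
  assumes a: "a \<in> carrier G" and b: "b \<in> carrier G" and y: "y \<in> carrier G"
    and rel: "y \<otimes> y \<otimes> b \<otimes> a = a \<otimes> y"
  shows "\<exists>h\<in>generate G {a, b}. inv h \<otimes> y \<in> lcs G N"
proof (induction N)
  case 0
  then show ?case using y by (intro bexI[of _ \<one>]) (auto intro: generate.one)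
next
  case (Suc N)
  interpret H: subgroup "generate G {a, b}" G using a b by (intro generate_is_subgroup) auto
  obtain h where hH: "h \<in> generate G {a, b}" and e: "inv h \<otimes> y \<in> lcs G N" using Suc by blast
  have h: "h \<in> carrier G" using hH by (rule H.mem_carrier)
  define z where "z = inv h \<otimes> y"
  have z: "z \<in> carrier G" using h y by (simp add: z_def)
  have yhz: "y = h \<otimes> z" using h y by (simp add: z_def m_assoc[symmetric])
  define K where "K = lcs G (Suc N)"
  interpret K: normal K G unfolding K_def by (rule lcs_normal)
  interpret c: group_hom G "G Mod K" "\<lambda>x. K #> x" by (intro Mod_hom K.normal_axioms)
  define c where "c x = K #> x" for x
  have c_mult: "c (u \<otimes> v) = c u \<otimes>\<^bsub>G Mod K\<^esub> c v" if "u \<in> carrier G" "v \<in> carrier G" for u v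
    unfolding c_def using that by (rule c.hom_mult)
  have c_closed: "c u \<in> carrier (G Mod K)" if "u \<in> carrier G" for u
    unfolding c_def using that by (rule c.hom_closed)
  have c_quot: "c (inv u \<otimes> v) = \<one>\<^bsub>G Mod K\<^esub>" if "c u = c v" "u \<in> carrier G" "v \<in> carrier G" for u v
    using c.hom_mult[OF inv_closed[OF that(2)] that(3)] c.hom_inv[OF that(2)] that c.H.l_inv[OF c.hom_closed[OF that(2)]]
    unfolding c_def by metis
  have comm: "c z \<otimes>\<^bsub>G Mod K\<^esub> c u = c u \<otimes>\<^bsub>G Mod K\<^esub> c z" if "u \<in> carrier G" for u
    unfolding c_def K_def using that e by (intro lcs_central) (simp_all add: z_def)
  \<comment> \<open>The right side of the solved relation with \<open>h\<close> in place of
    \<open>y\<close>; the discrepancy \<open>z\<close> drops out of the conjugate modulo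
    \<open>K\<close>.\<close>
  define h' where "h' = inv h \<otimes> a \<otimes> h \<otimes> inv a \<otimes> inv b"
  have h'H: "h' \<in> generate G {a, b}"
    unfolding h'_def using hH by (intro H.m_closed H.m_inv_closed) (auto intro: generate.incl)
  have h': "h' \<in> carrier G" using h'H by (rule H.mem_carrier)
  have "y \<otimes> (b \<otimes> a) = inv y \<otimes> (a \<otimes> y)"
  proof -
    have "inv y \<otimes> (a \<otimes> y) = inv y \<otimes> (y \<otimes> (y \<otimes> (b \<otimes> a)))"
      using a b y by (simp only: rel[symmetric] m_assoc m_closed)
    also have "\<dots> = y \<otimes> (b \<otimes> a)" using a b y by (simp add: m_assoc[symmetric])
    finally show ?thesis by simp
  qed
  also have "\<dots> = inv z \<otimes> (inv h \<otimes> a \<otimes> h) \<otimes> z"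
    using a h z by (simp add: yhz inv_mult_group m_assoc)
  finally have "c (y \<otimes> (b \<otimes> a)) = c (inv z) \<otimes>\<^bsub>G Mod K\<^esub> (c (inv h \<otimes> a \<otimes> h) \<otimes>\<^bsub>G Mod K\<^esub> c z)"
    using a h z by (simp add: c_mult c_closed c.H.m_assoc del: mult_FactGroup)
  also have "\<dots> = c (inv z \<otimes> z \<otimes> (inv h \<otimes> a \<otimes> h))"
    using a h z comm[of "inv h \<otimes> a \<otimes> h"]
    by (simp only: c_mult c_closed m_closed inv_closed c.H.m_closed)
      (simp only: c.H.m_assoc c_mult c_closed m_closed inv_closed c.H.m_closed)
  also have "inv z \<otimes> z \<otimes> (inv h \<otimes> a \<otimes> h) = h' \<otimes> (b \<otimes> a)"
    using a b h z by (simp add: h'_def m_assoc inv_solve_left) (simp add: m_assoc[symmetric])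
  finally have "c y = c h'"
    using a b y h' by (simp add: c_mult c_closed del: mult_FactGroup)
  then have "c (inv h' \<otimes> y) = \<one>\<^bsub>G Mod K\<^esub>"
    using y h' by (intro c_quot) simp_all
  then have "inv h' \<otimes> y \<in> K"
    using Mod_eq_one_iff[OF K.subgroup_axioms, of "inv h' \<otimes> y"] y h' unfolding c_def by blast
  then show ?case
    using h'H unfolding K_def by blast
qed

text \<open>The universal property gives \<open>\<phi>\<close> from \<open>\<F>\<close> onto
  \<open>G Mod lcs G N\<close>, and nilpotency of the target puts \<open>lcs \<F> N\<close> into its
  kernel. The map \<open>\<pi>\<close> in the other direction bounds the kernel from above. Torsion
  is asked for only modulo \<open>lcs G N\<close>, because in the second group the relation for
  \<open>\<beta>\<close> holds only there.\<close>

lemma (in free_prod) Mod_lcs_iso: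
  assumes G: "group G" and \<alpha>: "\<alpha> \<in> carrier G" and \<beta>: "\<beta> \<in> carrier G"
    and gen: "\<And>g. g \<in> carrier G \<Longrightarrow> \<exists>h\<in>generate G {\<alpha>, \<beta>}. inv\<^bsub>G\<^esub> h \<otimes>\<^bsub>G\<^esub> g \<in> lcs G N"
    and tor: "\<alpha> [^]\<^bsub>G\<^esub> m \<in> lcs G N" "\<beta> [^]\<^bsub>G\<^esub> n \<in> lcs G N"
    and \<pi>: "\<pi> \<in> hom G (\<F> Mod lcs \<F> N)"
      "\<pi> \<alpha> = lcs \<F> N #>\<^bsub>\<F>\<^esub> gen1" "\<pi> \<beta> = lcs \<F> N #>\<^bsub>\<F>\<^esub> gen2"
  shows "G Mod lcs G N \<cong> \<F> Mod lcs \<F> N"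
proof -
  interpret G: group G by fact
  interpret F: group \<F> by (rule group_F)
  define K where "K = lcs G N"
  define L where "L = lcs \<F> N"
  interpret K: normal K G unfolding K_def by (rule G.lcs_normal)
  interpret L: normal L \<F> unfolding L_def by (rule F.lcs_normal)
  interpret c: group_hom G "G Mod K" "\<lambda>x. K #>\<^bsub>G\<^esub> x" by (intro G.Mod_hom K.normal_axioms)
  interpret d: group_hom \<F> "\<F> Mod L" "\<lambda>x. L #>\<^bsub>\<F>\<^esub> x" by (intro F.Mod_hom L.normal_axioms)
  interpret \<pi>: group_hom G "\<F> Mod L" \<pi>
    using \<pi>(1) by unfold_locales (simp add: L_def)
  have one: "K #>\<^bsub>G\<^esub> g = \<one>\<^bsub>G Mod K\<^esub>" if "g \<in> K" for g
    using that G.Mod_eq_one_iff[OF K.subgroup_axioms, of g] by (simp add: K.mem_carrier)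
  have pow1: "(K #>\<^bsub>G\<^esub> \<alpha>) [^]\<^bsub>G Mod K\<^esub> m = \<one>\<^bsub>G Mod K\<^esub>"
    using one[OF tor(1)[folded K_def]] K.FactGroup_pow[OF \<alpha>] by metis
  have pow2: "(K #>\<^bsub>G\<^esub> \<beta>) [^]\<^bsub>G Mod K\<^esub> n = \<one>\<^bsub>G Mod K\<^esub>"
    using one[OF tor(2)[folded K_def]] K.FactGroup_pow[OF \<beta>] by metis
  obtain \<phi> where \<phi>: "\<phi> \<in> hom \<F> (G Mod K)" "\<phi> gen1 = K #>\<^bsub>G\<^esub> \<alpha>" "\<phi> gen2 = K #>\<^bsub>G\<^esub> \<beta>"
    by (rule hom_from_F[OF c.H.is_group c.hom_closed[OF \<alpha>] pow1 c.hom_closed[OF \<beta>] pow2])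
  interpret \<phi>: group_hom \<F> "G Mod K" \<phi>
    using \<phi>(1) by unfold_locales
  have base: "\<exists>g\<in>carrier G. \<phi> w = K #>\<^bsub>G\<^esub> g \<and> \<pi> g = L #>\<^bsub>\<F>\<^esub> w" if "w \<in> {gen1, gen2}" for w
    using that \<phi>(2,3) \<pi>(2,3) \<alpha> \<beta> unfolding L_def by blast
  \<comment> \<open>Every word has a lift \<open>g\<close> compatible with \<open>\<phi>\<close> and
    \<open>\<pi>\<close> at once. Such words are closed under the group operations, so the two
    generators suffice. If \<open>\<phi> w\<close> is trivial, then \<open>g\<close> lies in
    \<open>lcs G N\<close>, hence \<open>\<pi> g\<close> is trivial and \<open>w\<close> lies in
    \<open>L\<close>.\<close>
  have ex: "\<exists>g\<in>carrier G. \<phi> w = K #>\<^bsub>G\<^esub> g \<and> \<pi> g = L #>\<^bsub>\<F>\<^esub> w" if "w \<in> carrier \<F>" for w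
    using that unfolding generate_F[symmetric]
  proof (induction w rule: generate.induct)
    case one
    show ?case
      by (intro bexI[of _ "\<one>\<^bsub>G\<^esub>"] conjI)
        (simp_all only: c.hom_one d.hom_one \<phi>.hom_one \<pi>.hom_one G.one_closed)
  next
    case (incl h)
    then show ?case using base by blast
  next
    case (inv h)
    then have h: "h \<in> carrier \<F>" using gen_in_F by auto
    obtain g where "g \<in> carrier G" "\<phi> h = K #>\<^bsub>G\<^esub> g" "\<pi> g = L #>\<^bsub>\<F>\<^esub> h"
      using inv base by blast
    then show ?case using h
      by (intro bexI[of _ "inv\<^bsub>G\<^esub> g"] conjI)
        (simp_all only: c.hom_inv d.hom_inv \<phi>.hom_inv \<pi>.hom_inv G.inv_closed)
  next
    case (eng h1 h2)
    then obtain g1 g2 where g: "g1 \<in> carrier G" "\<phi> h1 = K #>\<^bsub>G\<^esub> g1" "\<pi> g1 = L #>\<^bsub>\<F>\<^esub> h1"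
      "g2 \<in> carrier G" "\<phi> h2 = K #>\<^bsub>G\<^esub> g2" "\<pi> g2 = L #>\<^bsub>\<F>\<^esub> h2" by blast
    have h: "h1 \<in> carrier \<F>" "h2 \<in> carrier \<F>" using eng(1,2) generate_F by auto
    show ?case using g h
      by (intro bexI[of _ "g1 \<otimes>\<^bsub>G\<^esub> g2"] conjI)
        (simp_all only: c.hom_mult d.hom_mult \<phi>.hom_mult \<pi>.hom_mult G.m_closed)
  qed
  have surj: "\<phi> ` carrier \<F> = carrier (G Mod K)"
  proof -
    have "\<phi> ` carrier \<F> = generate (G Mod K) (\<phi> ` {gen1, gen2})"
      using \<phi>.generate_img[of "{gen1, gen2}"] gen_in_F generate_F by simp
    also have "\<phi> ` {gen1, gen2} = (\<lambda>x. K #>\<^bsub>G\<^esub> x) ` {\<alpha>, \<beta>}" using \<phi> by simp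
    also have "generate (G Mod K) \<dots> = (\<lambda>x. K #>\<^bsub>G\<^esub> x) ` generate G {\<alpha>, \<beta>}"
      using \<alpha> \<beta> by (intro c.generate_img) auto
    also have "\<dots> = (\<lambda>x. K #>\<^bsub>G\<^esub> x) ` carrier G"
    proof
      show "(\<lambda>x. K #>\<^bsub>G\<^esub> x) ` generate G {\<alpha>, \<beta>} \<subseteq> (\<lambda>x. K #>\<^bsub>G\<^esub> x) ` carrier G"
        using G.generate_incl[of "{\<alpha>, \<beta>}"] \<alpha> \<beta> by blast
      show "(\<lambda>x. K #>\<^bsub>G\<^esub> x) ` carrier G \<subseteq> (\<lambda>x. K #>\<^bsub>G\<^esub> x) ` generate G {\<alpha>, \<beta>}"
      proof
        fix C assume "C \<in> (\<lambda>x. K #>\<^bsub>G\<^esub> x) ` carrier G"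
        then obtain g where g: "g \<in> carrier G" "C = K #>\<^bsub>G\<^esub> g" by blast
        obtain h where h: "h \<in> generate G {\<alpha>, \<beta>}" and hg: "inv\<^bsub>G\<^esub> h \<otimes>\<^bsub>G\<^esub> g \<in> K"
          using gen[OF g(1)] unfolding K_def by blast
        have h': "h \<in> carrier G" using h G.generate_in_carrier[of "{\<alpha>, \<beta>}"] \<alpha> \<beta> by auto
        have "K #>\<^bsub>G\<^esub> g = K #>\<^bsub>G\<^esub> (h \<otimes>\<^bsub>G\<^esub> (inv\<^bsub>G\<^esub> h \<otimes>\<^bsub>G\<^esub> g))"
          using g h' by (simp add: G.m_assoc[symmetric])
        also have "\<dots> = (K #>\<^bsub>G\<^esub> h) \<otimes>\<^bsub>G Mod K\<^esub> \<one>\<^bsub>G Mod K\<^esub>"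
          using g h' one[OF hg] by (simp only: c.hom_mult G.m_closed G.inv_closed)
        also have "\<dots> = K #>\<^bsub>G\<^esub> h" using h' c.hom_closed by (intro c.H.r_one)
        finally show "C \<in> (\<lambda>x. K #>\<^bsub>G\<^esub> x) ` generate G {\<alpha>, \<beta>}" using h g by blast
      qed
    qed
    finally show ?thesis by (simp add: carrier_FactGroup)
  qed
  have "kernel \<F> (G Mod K) \<phi> = L"
  proof
    show "L \<subseteq> kernel \<F> (G Mod K) \<phi>"
      using \<phi>.lcs_image[of N] G.lcs_Mod[of N] L.subset unfolding L_def K_def kernel_def by blast
    show "kernel \<F> (G Mod K) \<phi> \<subseteq> L"
    proof
      fix w assume "w \<in> kernel \<F> (G Mod K) \<phi>"
      then have w: "w \<in> carrier \<F>" "\<phi> w = \<one>\<^bsub>G Mod K\<^esub>" by (auto simp: kernel_def)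
      obtain g where g: "g \<in> carrier G" "\<phi> w = K #>\<^bsub>G\<^esub> g" "\<pi> g = L #>\<^bsub>\<F>\<^esub> w" using ex[OF w(1)] by blast
      have "g \<in> lcs G N" using g w G.Mod_eq_one_iff[OF K.subgroup_axioms, of g] by (simp add: K_def)
      then have "\<pi> g = \<one>\<^bsub>\<F> Mod L\<^esub>"
        using \<pi>.lcs_image[of N] F.lcs_Mod[of N] unfolding L_def by blast
      then show "w \<in> L" using g w F.Mod_eq_one_iff[OF L.subgroup_axioms, of w] by simp
    qed
  qed
  then have "\<F> Mod L \<cong> G Mod K" using \<phi>.FactGroup_iso[OF surj] by simp
  then show ?thesis unfolding K_def L_def
    using group.iso_sym[OF d.H.is_group] by (simp add: L_def)
qed

section \<open>Triangular matrices modulo an ideal\<close>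

definition ideal_set :: "'r::comm_ring_1 set \<Rightarrow> bool" where
  "ideal_set I \<longleftrightarrow> 0 \<in> I \<and> (\<forall>a\<in>I. \<forall>b\<in>I. a + b \<in> I) \<and> (\<forall>r. \<forall>a\<in>I. r * a \<in> I)"

lemma ideal_setD:
  assumes "ideal_set I"
  shows "0 \<in> I" "a \<in> I \<Longrightarrow> b \<in> I \<Longrightarrow> a + b \<in> I" "a \<in> I \<Longrightarrow> r * a \<in> I"
    "a \<in> I \<Longrightarrow> a * r \<in> I" "a \<in> I \<Longrightarrow> - a \<in> I" "a \<in> I \<Longrightarrow> b \<in> I \<Longrightarrow> a - b \<in> I"
proof -
  show *: "0 \<in> I" "a \<in> I \<Longrightarrow> b \<in> I \<Longrightarrow> a + b \<in> I" "a \<in> I \<Longrightarrow> r * a \<in> I" for a b r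
    using assms by (auto simp: ideal_set_def)
  show "a \<in> I \<Longrightarrow> a * r \<in> I" using *(3)[of a r] by (simp add: mult.commute)
  show **: "a \<in> I \<Longrightarrow> - a \<in> I" for a using *(3)[of a "-1"] by simp
  show "a \<in> I \<Longrightarrow> b \<in> I \<Longrightarrow> a - b \<in> I" using *(2)[of a "-b"] **[of b] by simp
qed

definition icong :: "'r::comm_ring_1 set \<Rightarrow> 'r \<Rightarrow> 'r \<Rightarrow> bool" where
  "icong I a b \<longleftrightarrow> a - b \<in> I"

lemma icong_refl: "ideal_set I \<Longrightarrow> icong I a a"
  by (simp add: icong_def ideal_setD)

lemma icong_sym: "ideal_set I \<Longrightarrow> icong I a b \<Longrightarrow> icong I b a"
  using ideal_setD(5)[of I "a - b"] by (simp add: icong_def)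

lemma icong_trans: "ideal_set I \<Longrightarrow> icong I a b \<Longrightarrow> icong I b c \<Longrightarrow> icong I a c"
  using ideal_setD(2)[of I "a - b" "b - c"] by (simp add: icong_def)

lemma icong_add: "ideal_set I \<Longrightarrow> icong I a a' \<Longrightarrow> icong I b b' \<Longrightarrow> icong I (a + b) (a' + b')"
  using ideal_setD(2)[of I "a - a'" "b - b'"] by (simp add: icong_def algebra_simps)

lemma icong_mult: "ideal_set I \<Longrightarrow> icong I a a' \<Longrightarrow> icong I b b' \<Longrightarrow> icong I (a * b) (a' * b')"
proof -
  assume *: "ideal_set I" "icong I a a'" "icong I b b'"
  have "a * b - a' * b' = a * (b - b') + b' * (a - a')" by (simp add: algebra_simps)
  then show ?thesis using * by (simp add: icong_def ideal_setD)
qed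

lemma icong_power: "ideal_set I \<Longrightarrow> icong I a b \<Longrightarrow> icong I (a ^ k) (b ^ k)"
  by (induction k) (auto intro: icong_mult icong_refl)

text \<open>The choice predicate depends only on the class of \<open>a\<close>, so one element per
  class is selected and the quotient ring is modelled inside the type of the ring, for an ideal that
  may depend on variables.\<close>

definition rep :: "'r::comm_ring_1 set \<Rightarrow> 'r \<Rightarrow> 'r" where
  "rep I a = (SOME b. icong I a b)"

lemma rep_icong: "ideal_set I \<Longrightarrow> icong I a (rep I a)"
  unfolding rep_def by (rule someI) (rule icong_refl)

lemma rep_eq_iff: "ideal_set I \<Longrightarrow> rep I a = rep I b \<longleftrightarrow> icong I a b"
proof
  assume I: "ideal_set I"
  show "icong I a b" if "rep I a = rep I b"
    using that rep_icong[OF I] icong_trans[OF I] icong_sym[OF I] by metis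
  show "rep I a = rep I b" if "icong I a b"
  proof -
    have "icong I a c \<longleftrightarrow> icong I b c" for c
      using that icong_trans[OF I] icong_sym[OF I] by metis
    then show ?thesis by (simp add: rep_def)
  qed
qed

section \<open>Groups of triangular matrices over a quotient ring\<close>

type_synonym 'r tri = "'r \<times> 'r \<times> 'r \<times> 'r \<times> 'r"

text \<open>The tuple \<open>(d, e, x, y, z)\<close> stands for the matrix with rows \<open>(d, x, z)\<close>, \<open>(0, e, s y)\<close>, \<open>(0, 0, 1)\<close>.\<close>

fun tri_mult :: "'r::comm_ring_1 \<Rightarrow> 'r tri \<Rightarrow> 'r tri \<Rightarrow> 'r tri" where
  "tri_mult s (d, e, x, y, z) (d', e', x', y', z') =
     (d * d', e * e', d * x' + x * e', e * y' + y, d * z' + s * x * y' + z)"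

definition tri_one :: "'r::comm_ring_1 tri" where "tri_one = (1, 1, 0, 0, 0)"

fun tri_pow :: "'r::comm_ring_1 \<Rightarrow> 'r tri \<Rightarrow> nat \<Rightarrow> 'r tri" where
  "tri_pow s t 0 = tri_one"
| "tri_pow s t (Suc k) = tri_mult s (tri_pow s t k) t"

fun tri_cong :: "'r::comm_ring_1 set \<Rightarrow> 'r tri \<Rightarrow> 'r tri \<Rightarrow> bool" where
  "tri_cong I (d, e, x, y, z) (d', e', x', y', z') \<longleftrightarrow>
     icong I d d' \<and> icong I e e' \<and> icong I x x' \<and> icong I y y' \<and> icong I z z'"

fun tri_rep :: "'r::comm_ring_1 set \<Rightarrow> 'r tri \<Rightarrow> 'r tri" where
  "tri_rep I (d, e, x, y, z) = (rep I d, rep I e, rep I x, rep I y, rep I z)"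

lemma tri_mult_assoc: "tri_mult s (tri_mult s t u) v = tri_mult s t (tri_mult s u v)"
  by (cases t; cases u; cases v) (simp add: algebra_simps)

lemma tri_mult_one: "tri_mult s tri_one t = t" "tri_mult s t tri_one = t"
  by (cases t; simp add: tri_one_def)+

lemma tri_cong_sym: "ideal_set I \<Longrightarrow> tri_cong I t u \<Longrightarrow> tri_cong I u t"
  by (cases t; cases u) (auto intro: icong_sym)

lemma tri_cong_trans: "ideal_set I \<Longrightarrow> tri_cong I t u \<Longrightarrow> tri_cong I u v \<Longrightarrow> tri_cong I t v"
  by (cases t; cases u; cases v) (auto intro: icong_trans)

lemma tri_cong_mult:
  "ideal_set I \<Longrightarrow> tri_cong I t t' \<Longrightarrow> tri_cong I u u' \<Longrightarrow> tri_cong I (tri_mult s t u) (tri_mult s t' u')"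
  by (cases t; cases u; cases t'; cases u') (auto intro!: icong_add icong_mult icong_refl)

lemma tri_rep_cong: "ideal_set I \<Longrightarrow> tri_cong I t (tri_rep I t)"
  by (cases t) (simp add: rep_icong)

lemma tri_rep_eq_iff: "ideal_set I \<Longrightarrow> tri_rep I t = tri_rep I u \<longleftrightarrow> tri_cong I t u"
  by (cases t; cases u) (simp add: rep_eq_iff)

lemma tri_rep_rep: "ideal_set I \<Longrightarrow> tri_rep I (tri_rep I t) = tri_rep I t"
  using tri_rep_eq_iff tri_cong_sym tri_rep_cong by metis

definition tri_monoid :: "'r::comm_ring_1 set \<Rightarrow> 'r \<Rightarrow> 'r tri monoid" where
  "tri_monoid I s = \<lparr>carrier = range (tri_rep I), monoid.mult = (\<lambda>t u. tri_rep I (tri_mult s t u)), one = tri_rep I tri_one\<rparr>"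

text \<open>Passing to the units of the monoid gives the group laws at once; membership then means
  exhibiting a two-sided inverse modulo \<open>I\<close>.\<close>

definition tri_group :: "'r::comm_ring_1 set \<Rightarrow> 'r \<Rightarrow> 'r tri monoid" where
  "tri_group I s = units_of (tri_monoid I s)"

lemma tri_rep_mult_rep:
  assumes "ideal_set I"
  shows "tri_rep I (tri_mult s (tri_rep I t) (tri_rep I u)) = tri_rep I (tri_mult s t u)"
  using assms by (simp add: tri_rep_eq_iff) (intro tri_cong_mult tri_cong_sym[OF _ tri_rep_cong])

lemma tri_monoid: 
  assumes I: "ideal_set I"
  shows "Group.monoid (tri_monoid I s)"
proof (rule monoidI)
  fix t u v
  assume "t \<in> carrier (tri_monoid I s)" "u \<in> carrier (tri_monoid I s)" "v \<in> carrier (tri_monoid I s)"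
  then obtain t' u' v' where [simp]: "t = tri_rep I t'" "u = tri_rep I u'" "v = tri_rep I v'"
    by (auto simp: tri_monoid_def)
  show "t \<otimes>\<^bsub>tri_monoid I s\<^esub> u \<otimes>\<^bsub>tri_monoid I s\<^esub> v = t \<otimes>\<^bsub>tri_monoid I s\<^esub> (u \<otimes>\<^bsub>tri_monoid I s\<^esub> v)"
    by (simp add: tri_monoid_def tri_rep_mult_rep[OF I] tri_mult_assoc)
next
  fix t assume "t \<in> carrier (tri_monoid I s)"
  then obtain t' where [simp]: "t = tri_rep I t'" by (auto simp: tri_monoid_def)
  show "\<one>\<^bsub>tri_monoid I s\<^esub> \<otimes>\<^bsub>tri_monoid I s\<^esub> t = t" "t \<otimes>\<^bsub>tri_monoid I s\<^esub> \<one>\<^bsub>tri_monoid I s\<^esub> = t"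
    by (simp_all add: tri_monoid_def tri_rep_mult_rep[OF I] tri_mult_one)
qed (simp_all add: tri_monoid_def)

lemma tri_group: "ideal_set I \<Longrightarrow> group (tri_group I s)"
  unfolding tri_group_def by (intro monoid.units_group tri_monoid)

lemma mult_tri_group: "t \<otimes>\<^bsub>tri_group I s\<^esub> u = tri_rep I (tri_mult s t u)"
  by (simp add: tri_group_def units_of_def tri_monoid_def)

lemma mult_tri_rep:
  "ideal_set I \<Longrightarrow> tri_rep I t \<otimes>\<^bsub>tri_group I s\<^esub> tri_rep I u = tri_rep I (tri_mult s t u)"
  by (simp add: mult_tri_group tri_rep_mult_rep)

lemma one_tri_group: "\<one>\<^bsub>tri_group I s\<^esub> = tri_rep I tri_one"
  by (simp add: tri_group_def units_of_def tri_monoid_def)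

lemma pow_tri_rep:
  "ideal_set I \<Longrightarrow> tri_rep I t [^]\<^bsub>tri_group I s\<^esub> (k::nat) = tri_rep I (tri_pow s t k)"
  by (induction k) (simp_all add: one_tri_group mult_tri_rep)

lemma carrier_tri_group_rep:
  "ideal_set I \<Longrightarrow> t \<in> carrier (tri_group I s) \<Longrightarrow> tri_rep I t = t"
proof -
  assume I: "ideal_set I" and "t \<in> carrier (tri_group I s)"
  then obtain t' where "t = tri_rep I t'" by (auto simp: tri_group_def units_of_def Units_def tri_monoid_def)
  then show "tri_rep I t = t" using tri_rep_rep[OF I] by simp
qed

lemma tri_rep_in_carrierI:
  assumes I: "ideal_set I" and "tri_cong I (tri_mult s t u) tri_one" "tri_cong I (tri_mult s u t) tri_one"
  shows "tri_rep I t \<in> carrier (tri_group I s)"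
proof -
  have "tri_rep I (tri_mult s t u) = tri_rep I tri_one" "tri_rep I (tri_mult s u t) = tri_rep I tri_one"
    using assms by (simp_all add: tri_rep_eq_iff)
  then have "\<exists>u'\<in>range (tri_rep I). tri_rep I (tri_mult s u' (tri_rep I t)) = tri_rep I tri_one \<and>
      tri_rep I (tri_mult s (tri_rep I t) u') = tri_rep I tri_one"
    by (intro bexI[of _ "tri_rep I u"]) (simp_all add: tri_rep_mult_rep[OF I])
  then show ?thesis
    unfolding tri_group_def units_of_def Units_def tri_monoid_def by simp
qed

lemma tri_rep_in_carrier:
  assumes I: "ideal_set I" and d: "icong I (d * d') 1" and e: "icong I (e * e') 1"
  shows "tri_rep I (d, e, x, y, z) \<in> carrier (tri_group I s)"
proof (rule tri_rep_in_carrierI[OF I])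
  \<comment> \<open>The usual inverse of a triangular matrix, with \<open>d'\<close> and
    \<open>e'\<close> standing for the inverses of the diagonal entries modulo
    \<open>I\<close>.\<close>
  let ?u = "(d', e', - (d' * x * e'), - (e' * y), - (d' * z) + s * d' * x * e' * y)"
  have d1: "d * d' - 1 \<in> I" and e1: "e * e' - 1 \<in> I" using d e by (auto simp: icong_def)
  have "- (x * e' * (d * d' - 1)) \<in> I" "- (y * (e * e' - 1)) \<in> I"
     "(s * x * e' * y - z) * (d * d' - 1) \<in> I" "- (d' * x) * (e * e' - 1) \<in> I"
     using d1 e1 ideal_setD[OF I] by blast+
  moreover have "d * - (d' * x * e') + x * e' = - (x * e' * (d * d' - 1))" "e * - (e' * y) + y = - (y * (e * e' - 1))"
    "d * (- (d' * z) + s * d' * x * e' * y) + s * x * - (e' * y) + z = (s * x * e' * y - z) * (d * d' - 1)"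
    "d' * x + - (d' * x * e') * e = - (d' * x) * (e * e' - 1)"
    by (simp_all add: algebra_simps)
  ultimately have *: "d * - (d' * x * e') + x * e' \<in> I" "e * - (e' * y) + y \<in> I"
    "d * (- (d' * z) + s * d' * x * e' * y) + s * x * - (e' * y) + z \<in> I"
    "d' * x + - (d' * x * e') * e \<in> I"
    by (simp_all only:)
  show "tri_cong I (tri_mult s (d, e, x, y, z) ?u) tri_one"
    using * d1 e1 by (simp add: tri_one_def icong_def)
  have "e' * y + - (e' * y) = 0" by simp
  moreover have "d' * z + s * - (d' * x * e') * y + (- (d' * z) + s * d' * x * e' * y) = 0"
    by (simp add: algebra_simps)
  ultimately show "tri_cong I (tri_mult s ?u (d, e, x, y, z)) tri_one"
    using * d1 e1 ideal_setD(1)[OF I] by (simp add: tri_one_def icong_def mult.commute)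
qed

text \<open>Common source of three kinds of maps: reduction to a larger ideal (with \<open>F\<close>
  the identity), specialisation of the coefficient ring, and forgetting entries.\<close>

lemma tri_hom:
  assumes I: "ideal_set I" and I': "ideal_set I'"
    and F_mult: "\<And>t u. F (tri_mult s t u) = tri_mult s' (F t) (F u)" and F_one: "F tri_one = tri_one"
    and F_cong: "\<And>t u. tri_cong I t u \<Longrightarrow> tri_cong I' (F t) (F u)"
  shows "(\<lambda>t. tri_rep I' (F t)) \<in> hom (tri_group I s) (tri_group I' s')"
    and "tri_rep I' (F (tri_rep I t)) = tri_rep I' (F t)"
proof -
  have rep: "tri_rep I' (F (tri_rep I t)) = tri_rep I' (F t)" for t
    using F_cong[OF tri_rep_cong[OF I]] by (simp add: tri_rep_eq_iff[OF I'] tri_cong_sym[OF I'])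
  show "tri_rep I' (F (tri_rep I t)) = tri_rep I' (F t)" by (rule rep)
  interpret T: group "tri_group I s" by (rule tri_group[OF I])
  show "(\<lambda>t. tri_rep I' (F t)) \<in> hom (tri_group I s) (tri_group I' s')"
  proof (rule homI)
    fix t u assume t: "t \<in> carrier (tri_group I s)" and u: "u \<in> carrier (tri_group I s)"
    show "tri_rep I' (F (t \<otimes>\<^bsub>tri_group I s\<^esub> u)) = tri_rep I' (F t) \<otimes>\<^bsub>tri_group I' s'\<^esub> tri_rep I' (F u)"
      by (simp add: mult_tri_group rep F_mult tri_rep_mult_rep[OF I'])
  next
    fix t assume t: "t \<in> carrier (tri_group I s)"
    define u where "u = inv\<^bsub>tri_group I s\<^esub> t"
    have u: "tri_rep I (tri_mult s t u) = tri_rep I tri_one" "tri_rep I (tri_mult s u t) = tri_rep I tri_one"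
      using T.r_inv[OF t] T.l_inv[OF t] by (simp_all add: u_def mult_tri_group one_tri_group)
    show "tri_rep I' (F t) \<in> carrier (tri_group I' s')"
    proof (rule tri_rep_in_carrierI[OF I'])
      show "tri_cong I' (tri_mult s' (F t) (F u)) tri_one" "tri_cong I' (tri_mult s' (F u) (F t)) tri_one"
        using u F_cong by (simp_all add: tri_rep_eq_iff[OF I] F_mult[symmetric] F_one[symmetric])
    qed
  qed
qed

text \<open>For matrices 1 + X and 1 + Y the two products differ by XY - YX, whose entries are sums
  of products of an element of \<open>I\<close> and one of \<open>J\<close>.\<close>

lemma tri_commute_mod:
  assumes K: "ideal_set K"
    and IJ: "\<And>a b. a \<in> I \<Longrightarrow> b \<in> J \<Longrightarrow> a * b \<in> K"
    and I: "ideal_set I" and J: "ideal_set J"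
    and t: "tri_cong I t tri_one" and u: "tri_cong J u tri_one"
  shows "tri_cong K (tri_mult s t u) (tri_mult s u t)"
proof -
  obtain d e x y z where t': "t = (d, e, x, y, z)" by (cases t)
  obtain d' e' x' y' z' where u': "u = (d', e', x', y', z')" by (cases u)
  have a: "d - 1 \<in> I" "e - 1 \<in> I" "x \<in> I" "y \<in> I" "z \<in> I"
    using t by (simp_all add: t' tri_one_def icong_def)
  have b: "d' - 1 \<in> J" "e' - 1 \<in> J" "x' \<in> J" "y' \<in> J" "z' \<in> J"
    using u by (simp_all add: u' tri_one_def icong_def)
  have "(d - 1) * x' - (e - 1) * x' + (x * (e' - 1) - x * (d' - 1)) \<in> K"
    "(e - 1) * y' - y * (e' - 1) \<in> K"
    "(d - 1) * z' - z * (d' - 1) + s * (x * y' - y * x') \<in> K"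
    by (intro ideal_setD[OF K] IJ a b)+
  moreover have "d * x' + x * e' - (d' * x + x' * e) = (d - 1) * x' - (e - 1) * x' + (x * (e' - 1) - x * (d' - 1))"
    "e * y' + y - (e' * y + y') = (e - 1) * y' - y * (e' - 1)"
    "d * z' + s * x * y' + z - (d' * z + s * x' * y + z') = (d - 1) * z' - z * (d' - 1) + s * (x * y' - y * x')"
    by (simp_all add: algebra_simps)
  ultimately show ?thesis
    by (simp add: t' u' icong_def mult.commute ideal_setD(1)[OF K])
qed

text \<open>The congruence subgroups of a multiplicative filtration behave like a central series:
  commuting with an element that is 1 modulo \<open>J 1\<close> gains one step of the
  filtration.\<close>

lemma lcs_tri_filtration:
  assumes G: "group G" and I: "ideal_set I" and \<theta>: "\<theta> \<in> hom G (tri_group I s)"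
    and J: "\<And>k. ideal_set (J k)" and IJ: "\<And>k. I \<subseteq> J k"
    and J_mult: "\<And>k a b. a \<in> J 1 \<Longrightarrow> b \<in> J k \<Longrightarrow> a * b \<in> J (Suc k)"
    and base: "\<And>g. g \<in> carrier G \<Longrightarrow> tri_cong (J 1) (\<theta> g) tri_one"
  shows "g \<in> lcs G n \<Longrightarrow> tri_cong (J (Suc n)) (\<theta> g) tri_one"
proof (induction n arbitrary: g)
  case 0
  then show ?case using base by simp
next
  case (Suc n)
  interpret G: group G by fact
  \<comment> \<open>Reducing modulo the next ideal turns the claim into membership in the kernel of
    a homomorphism, which only has to be checked on commutators.\<close>
  define K where "K = J (Suc (Suc n))"
  have K: "ideal_set K" by (simp add: K_def J)
  have "icong K a b" if "icong I a b" for a b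
    using that IJ by (auto simp: icong_def K_def)
  then have IK: "tri_cong K t u" if "tri_cong I t u" for t u
    using that by (cases t; cases u) simp
  note hom = tri_hom[OF I K, where F = "\<lambda>t. t" and s = s and s' = s, OF refl refl IK]
  define h where "h = (\<lambda>g. tri_rep K (\<theta> g))"
  have "h \<in> hom G (tri_group K s)"
    using hom_compose[OF \<theta> hom(1)] by (simp add: h_def comp_def)
  then interpret h: group_hom G "tri_group K s" h
    by (intro group_hom.intro group_hom_axioms.intro G tri_group[OF K])
  have h_one: "h g = \<one>\<^bsub>tri_group K s\<^esub> \<longleftrightarrow> tri_cong K (\<theta> g) tri_one" for g
    by (simp add: h_def one_tri_group tri_rep_eq_iff[OF K])
  have "comm_set G (carrier G) (lcs G n) \<subseteq> kernel G (tri_group K s) h"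
  proof
    fix c assume "c \<in> comm_set G (carrier G) (lcs G n)"
    then obtain x y where x: "x \<in> carrier G" and y: "y \<in> lcs G n"
      and c: "c = x \<otimes>\<^bsub>G\<^esub> y \<otimes>\<^bsub>G\<^esub> inv\<^bsub>G\<^esub> x \<otimes>\<^bsub>G\<^esub> inv\<^bsub>G\<^esub> y" by (auto simp: comm_set_def)
    have y': "y \<in> carrier G" using y G.lcs_normal[of n] by (meson normal_imp_subgroup subgroup.mem_carrier)
    have "tri_cong K (tri_mult s (\<theta> x) (\<theta> y)) (tri_mult s (\<theta> y) (\<theta> x))"
      by (rule tri_commute_mod[OF K _ J J base[OF x] Suc.IH[OF y]]) (auto simp: K_def intro: J_mult)
    then have "h x \<otimes>\<^bsub>tri_group K s\<^esub> h y = h y \<otimes>\<^bsub>tri_group K s\<^esub> h x"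
      by (simp add: h_def mult_tri_rep[OF K] tri_rep_eq_iff[OF K])
    moreover have "h c = (h x \<otimes>\<^bsub>tri_group K s\<^esub> h y) \<otimes>\<^bsub>tri_group K s\<^esub> inv\<^bsub>tri_group K s\<^esub> (h y \<otimes>\<^bsub>tri_group K s\<^esub> h x)"
      using x y' by (simp add: c h.H.inv_mult_group h.H.m_assoc)
    ultimately have "h c = \<one>\<^bsub>tri_group K s\<^esub>"
      using x y' by simp
    then show "c \<in> kernel G (tri_group K s) h"
      using x y' by (simp add: kernel_def c)
  qed
  then have "lcs G (Suc n) \<subseteq> kernel G (tri_group K s) h"
    by (simp add: G.generate_subgroup_incl h.subgroup_kernel)
  then have "h g = \<one>\<^bsub>tri_group K s\<^esub>" using Suc.prems by (auto simp: kernel_def)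
  then show ?case using h_one[of g] unfolding K_def by blast
qed

section \<open>Principal ideals and powers of an ideal modulo \<open>q\<close>\<close>

definition multiples :: "'r::comm_ring_1 \<Rightarrow> 'r set" where
  "multiples q = {a. q dvd a}"

lemma ideal_multiples: "ideal_set (multiples q)"
  by (auto simp: ideal_set_def multiples_def)

lemma icong_multiples: "icong (multiples q) a b \<longleftrightarrow> q dvd a - b"
  by (simp add: icong_def multiples_def)

lemma icong_multiplesI: "a - b = q * c \<Longrightarrow> icong (multiples q) a b"
  by (simp add: icong_multiples)

text \<open>The preimage, in the ring, of the \<open>k\<close>-th power of the ideal generated by
  \<open>\<pi>\<close> in the quotient by \<open>q\<close>.\<close>

definition power_ideal :: "'r::comm_ring_1 \<Rightarrow> 'r \<Rightarrow> nat \<Rightarrow> 'r set" where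
  "power_ideal \<pi> q k = {u * \<pi> ^ k + v * q | u v. True}"

lemma ideal_power_ideal: "ideal_set (power_ideal \<pi> q k)"
  unfolding ideal_set_def
proof (intro conjI ballI allI)
  have "0 = 0 * \<pi> ^ k + 0 * q" by simp
  then show "0 \<in> power_ideal \<pi> q k" unfolding power_ideal_def by blast
next
  fix a b assume "a \<in> power_ideal \<pi> q k" "b \<in> power_ideal \<pi> q k"
  then obtain u v u' v' where "a = u * \<pi> ^ k + v * q" "b = u' * \<pi> ^ k + v' * q"
    by (auto simp: power_ideal_def)
  then have "a + b = (u + u') * \<pi> ^ k + (v + v') * q" by (simp add: algebra_simps)
  then show "a + b \<in> power_ideal \<pi> q k" unfolding power_ideal_def by blast
next
  fix r a assume "a \<in> power_ideal \<pi> q k"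
  then obtain u v where "a = u * \<pi> ^ k + v * q" by (auto simp: power_ideal_def)
  then have "r * a = (r * u) * \<pi> ^ k + (r * v) * q" by (simp add: algebra_simps)
  then show "r * a \<in> power_ideal \<pi> q k" unfolding power_ideal_def by blast
qed

lemma power_ideal_mult:
  assumes "a \<in> power_ideal \<pi> q 1" "b \<in> power_ideal \<pi> q k"
  shows "a * b \<in> power_ideal \<pi> q (Suc k)"
proof -
  obtain u v u' v' where "a = u * \<pi> + v * q" "b = u' * \<pi> ^ k + v' * q"
    using assms by (auto simp: power_ideal_def)
  then have "a * b = (u * u') * \<pi> ^ Suc k + (u * \<pi> * v' + v * u' * \<pi> ^ k + v * v' * q) * q"
    by (simp add: algebra_simps)
  then show ?thesis unfolding power_ideal_def by blast
qed

lemma multiples_subset_power_ideal: "multiples q \<subseteq> power_ideal \<pi> q k"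
proof
  fix a assume "a \<in> multiples q"
  then obtain v where "a = 0 * \<pi> ^ k + v * q" by (auto simp: multiples_def mult.commute[of q])
  then show "a \<in> power_ideal \<pi> q k" unfolding power_ideal_def by blast
qed

lemma dvd_in_power_ideal: "\<pi> dvd a \<Longrightarrow> a \<in> power_ideal \<pi> q 1"
proof -
  assume "\<pi> dvd a"
  then obtain u where "a = u * \<pi> ^ 1 + 0 * q" by (auto simp: mult.commute[of \<pi>])
  then show ?thesis unfolding power_ideal_def by blast
qed

text \<open>Here \<open>z\<close> is a root of unity and \<open>e\<close> its inverse. The entries come from solving \<open>Y Y B A = A Y\<close>
  under the condition that \<open>B - 1\<close> has rank one, which makes \<open>B\<close> torsion. For \<open>i = 0\<close> this
  determines the corner entry of \<open>Y\<close> as a multiple of \<open>1 / (z - 2)\<close>; the scaling factor \<open>s = z - 2\<close> in the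
  \<open>(2, 3)\<close> entries cancels this denominator, so that the corner entry survives the reduction \<open>z \<mapsto> 2\<close>
  although \<open>B\<close> becomes trivial there.\<close>

definition tri_A :: "'r::comm_ring_1 \<Rightarrow> 'r \<Rightarrow> nat \<Rightarrow> 'r tri" where
  "tri_A z e i = (if i = 0 then (z, e, 0, 0, 0) else (z ^ i, 1, 0, 0, 0))"

definition tri_Y :: "'r::comm_ring_1 \<Rightarrow> 'r \<Rightarrow> nat \<Rightarrow> 'r tri" where
  "tri_Y z e i = (if i = 0
     then (1, e, z - 1, z - 1, (z - 1) * ((z - 1) * (1 - z^2 - z) - z^2 * (z^2 - 1 - z)))
     else (e, 1, 0, 0, z - 1))"

definition tri_B :: "'r::comm_ring_1 \<Rightarrow> 'r \<Rightarrow> nat \<Rightarrow> 'r tri" where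
  "tri_B z e i = (if i = 0
     then (1, z, (z - 1) * (z^2 - 1 - z), - ((z - 1) * z^2), - ((z - 2) * (z - 1) * (z^2 - 1 - z) * z^2))
     else (z, 1, 0, 0, (z - 1) * (z^2 * (z ^ i - 1 - e))))"

lemma tri_relation:
  assumes I: "ideal_set I" and ze: "icong I (z * e) 1"
  shows "tri_cong I (tri_mult (z - 2) (tri_mult (z - 2) (tri_mult (z - 2) (tri_Y z e i) (tri_Y z e i)) (tri_B z e i)) (tri_A z e i))
           (tri_mult (z - 2) (tri_A z e i) (tri_Y z e i))"
proof -
  \<comment> \<open>Entry by entry, the difference of the two sides is z e - 1 times an explicit
    cofactor; the cofactors are supplied as the last instantiation below.\<close>
  have *: "icong I a b" if "a - b = (z * e - 1) * c" for a b c
    using ze that ideal_setD(4)[OF I] by (simp add: icong_def)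
  show ?thesis
  proof (cases "i = 0")
    case True
    show ?thesis
      unfolding tri_A_def tri_Y_def tri_B_def if_P[OF True] tri_mult.simps tri_cong.simps
    proof (intro conjI)
      show "icong I (1 * 1 * 1 * z) (z * 1)" by (rule *[of _ _ 0]) simp
      show "icong I (e * e * z * e) (e * e)" by (rule *[of _ _ "e^2"]) (simp add: algebra_simps power2_eq_square)
      show "icong I (1 * 1 * 1 * 0 + (1 * 1 * ((z - 1) * (z\<^sup>2 - 1 - z)) + (1 * (z - 1) + (z - 1) * e) * z) * e)
         (z * (z - 1) + 0 * e)"
        by (rule *[of _ _ "- e - z + z * e + z^2"]) (simp add: algebra_simps power2_eq_square)
      show "icong I (e * e * z * 0 + (e * e * - ((z - 1) * z\<^sup>2) + (e * (z - 1) + (z - 1)))) (e * (z - 1) + 0)"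
        by (rule *[of _ _ "1 - z + z * e - z^2 * e"]) (simp add: algebra_simps power2_eq_square)
    next
      show "icong I (1 * 1 * 1 * 0 + (z - 2) * (1 * 1 * ((z - 1) * (z\<^sup>2 - 1 - z)) + (1 * (z - 1) + (z - 1) * e) * z) * 0 +
       (1 * 1 * - ((z - 2) * (z - 1) * (z\<^sup>2 - 1 - z) * z\<^sup>2) +
        (z - 2) * (1 * (z - 1) + (z - 1) * e) * - ((z - 1) * z\<^sup>2) +
        (1 * ((z - 1) * ((z - 1) * (1 - z\<^sup>2 - z) - z\<^sup>2 * (z\<^sup>2 - 1 - z))) + (z - 2) * (z - 1) * (z - 1) +
         (z - 1) * ((z - 1) * (1 - z\<^sup>2 - z) - z\<^sup>2 * (z\<^sup>2 - 1 - z)))))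
       (z * ((z - 1) * ((z - 1) * (1 - z\<^sup>2 - z) - z\<^sup>2 * (z\<^sup>2 - 1 - z))) + (z - 2) * 0 * (z - 1) + 0)"
        by (rule *[of _ _ "2 * z - 5 * z^2 + 4 * z^3 - z^4"])
          (simp add: algebra_simps power2_eq_square power3_eq_cube power4_eq_xxxx)
    qed
  next
    case False
    define w where "w = z ^ i"
    show ?thesis
      unfolding tri_A_def tri_Y_def tri_B_def if_not_P[OF False] tri_mult.simps tri_cong.simps w_def[symmetric]
    proof (intro conjI)
      show "icong I (e * e * z * w) (w * e)" by (rule *[of _ _ "e * w"]) (simp add: algebra_simps)
      show "icong I (e * e * z * 0 + (z - 2) * (e * e * 0 + (e * 0 + 0 * 1) * 1) * 0 +
        (e * e * ((z - 1) * (z\<^sup>2 * (w - 1 - e))) + (z - 2) * (e * 0 + 0 * 1) * 0 + (e * (z - 1) + (z - 2) * 0 * 0 + (z - 1))))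
        (w * (z - 1) + (z - 2) * 0 * 0 + 0)"
        by (rule *[of _ _ "1 - w + e - z + z * w - z * e * w + z * e^2 - z^2 * e + z^2 * e * w - z^2 * e^2"])
          (simp add: algebra_simps power2_eq_square)
    qed (rule *[of _ _ 0], simp)+
  qed
qed

lemma tri_pow_A: "tri_pow s (tri_A z e i) j = (if i = 0 then (z ^ j, e ^ j, 0, 0, 0) else (z ^ (i * j), 1, 0, 0, 0))"
  by (induction j) (auto simp: tri_A_def tri_one_def power_add algebra_simps)

text \<open>B - 1 has rank one and trace z - 1, so (B - 1)^2 = (z - 1)(B - 1). Hence B^j - 1 arises
  from B - 1 by replacing the factor z - 1 with z^j - 1, and B^p = 1 follows from z^p = 1.\<close>

lemma tri_pow_B:
  "tri_pow (z - 2) (tri_B z e i) j = (if i = 0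
     then (1, z ^ j, (z ^ j - 1) * (z^2 - 1 - z), - ((z ^ j - 1) * z^2), - ((z - 2) * (z ^ j - 1) * (z^2 - 1 - z) * z^2))
     else (z ^ j, 1, 0, 0, (z ^ j - 1) * (z^2 * (z ^ i - 1 - e))))"
  by (induction j) (simp_all add: tri_B_def tri_one_def algebra_simps power2_eq_square)

lemma tri_A_carrier:
  assumes I: "ideal_set I" and ze: "icong I (z * e) 1"
  shows "tri_rep I (tri_A z e i) \<in> carrier (tri_group I s)"
proof (cases "i = 0")
  case True
  show ?thesis unfolding tri_A_def if_P[OF True]
    by (rule tri_rep_in_carrier[OF I ze]) (use ze in \<open>simp add: mult.commute\<close>)
next
  case False
  have "icong I (z ^ i * e ^ i) 1"
    using icong_power[OF I ze, of i] by (simp add: power_mult_distrib)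
  then show ?thesis unfolding tri_A_def if_not_P[OF False]
    by (rule tri_rep_in_carrier[OF I]) (simp add: icong_refl[OF I], rule icong_refl[OF I])
qed

lemma tri_Y_carrier:
  assumes I: "ideal_set I" and ze: "icong I (z * e) 1"
  shows "tri_rep I (tri_Y z e i) \<in> carrier (tri_group I s)"
proof -
  have ez: "icong I (e * z) 1" using ze by (simp add: mult.commute)
  have oo: "icong I (1 * 1) 1" using icong_refl[OF I] by simp
  show ?thesis unfolding tri_Y_def
    using tri_rep_in_carrier[OF I oo ez] tri_rep_in_carrier[OF I ez oo] by auto
qed

lemma tri_B_carrier:
  assumes I: "ideal_set I" and ze: "icong I (z * e) 1"
  shows "tri_rep I (tri_B z e i) \<in> carrier (tri_group I s)"
proof -
  have oo: "icong I (1 * 1) 1" using icong_refl[OF I] by simp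
  show ?thesis unfolding tri_B_def
    using tri_rep_in_carrier[OF I oo ze] tri_rep_in_carrier[OF I ze oo] by auto
qed

lemma tri_A_pow_eq_one:
  assumes I: "ideal_set I" and ze: "icong I (z * e) 1" and zp: "icong I (z ^ p) 1"
  shows "tri_rep I (tri_A z e i) [^]\<^bsub>tri_group I s\<^esub> p = \<one>\<^bsub>tri_group I s\<^esub>"
proof -
  have "icong I (z ^ p * e ^ p) 1"
    using icong_power[OF I ze, of p] by (simp add: power_mult_distrib)
  moreover have "icong I (z ^ p * e ^ p) (1 * e ^ p)"
    by (intro icong_mult I zp icong_refl)
  ultimately have "icong I (e ^ p) 1"
    using icong_sym[OF I] icong_trans[OF I] by (metis mult_1)
  moreover have "icong I (z ^ (i * p)) 1"
    using icong_power[OF I zp, of i] by (simp add: power_mult[symmetric] mult.commute)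
  ultimately show ?thesis
    using zp by (simp add: pow_tri_rep[OF I] one_tri_group rep_eq_iff[OF I] tri_pow_A tri_one_def)
qed

lemma tri_B_pow_eq_one:
  assumes I: "ideal_set I" and zp: "icong I (z ^ p) 1"
  shows "tri_rep I (tri_B z e i) [^]\<^bsub>tri_group I (z - 2)\<^esub> p = \<one>\<^bsub>tri_group I (z - 2)\<^esub>"
proof -
  have "icong I ((z ^ p - 1) * a) 0" "icong I (- ((z ^ p - 1) * a)) 0"
    "icong I (- ((z - 2) * (z ^ p - 1) * a * b)) 0" for a b
    using zp ideal_setD(3-5)[OF I] by (simp_all add: icong_def)
  then show ?thesis
    using zp by (simp add: pow_tri_rep[OF I] one_tri_group rep_eq_iff[OF I] tri_pow_B tri_one_def)
qed

section \<open>Affine quotients and torsion generators\<close>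

text \<open>The inner binomial coefficients are divisible by \<open>p\<close>, and oddness fixes the
  sign of the constant term. Applied to x = 2 for coprimality and to the polynomial variable for
  residual nilpotence.\<close>

lemma prime_power_minus_one:
  fixes x :: "'r::comm_ring_1"
  assumes "Factorial_Ring.prime p" "odd p"
  shows "of_nat p dvd (x - 1) ^ p - (x ^ p - 1)"
proof -
  have p: "0 < p" using assms(1) by (simp add: prime_gt_0_nat)
  have "(x - 1) ^ p = (\<Sum>k\<le>p. of_nat (p choose k) * x ^ k * (- 1) ^ (p - k))"
    using binomial_ring[of x "-1" p] by simp
  also have "{..p} = insert 0 (insert p {1..<p})" using p by auto
  also have "(\<Sum>k\<in>insert 0 (insert p {1..<p}). of_nat (p choose k) * x ^ k * (- 1) ^ (p - k))
    = - 1 + (x ^ p + (\<Sum>k\<in>{1..<p}. of_nat (p choose k) * x ^ k * (- 1) ^ (p - k)))"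
    using p assms(2) by (subst sum.insert) auto
  finally have "(x - 1) ^ p - (x ^ p - 1) = (\<Sum>k\<in>{1..<p}. of_nat (p choose k) * x ^ k * (- 1) ^ (p - k))"
    by simp
  also have "of_nat p dvd \<dots>"
  proof (rule dvd_sum)
    fix k assume k: "k \<in> {1..<p}"
    then have "p dvd (p choose k)" using assms(1) by (intro dvd_choose_prime) auto
    then have "(of_nat p :: 'r) dvd of_nat (p choose k)" by (auto simp: dvd_def)
    then show "(of_nat p :: 'r) dvd of_nat (p choose k) * x ^ k * (- 1) ^ (p - k)" by (intro dvd_mult2)
  qed
  finally show ?thesis .
qed

text \<open>Taking x = 2 above shows that 2^p - 1 is congruent to 1 modulo \<open>p\<close>.\<close>

lemma coprime_two_power_minus_one:
  assumes "Factorial_Ring.prime p" "odd p"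
  shows "coprime (2 ^ p - 1 :: int) (int p ^ r)"
proof -
  obtain h :: int where "1 - (2 ^ p - 1) = int p * h"
    using prime_power_minus_one[OF assms, of "2 :: int"] by (auto simp: dvd_def)
  then have h: "1 = (2 ^ p - 1) + int p * h" by simp
  have "coprime (2 ^ p - 1 :: int) (int p)"
  proof (rule coprimeI)
    fix c :: int assume "c dvd 2 ^ p - 1" "c dvd int p"
    then have "c dvd (2 ^ p - 1) + int p * h" by simp
    then show "is_unit c" using h by simp
  qed
  then show ?thesis by simp
qed

text \<open>The inclusion covers the empty set, singletons, and a pair with one trivial member. The
  first two serve the lower bound on the rank, the last the case of a generator that dies in a
  quotient.\<close>

lemma (in group) generate_with_one_commute:
  assumes v: "v \<in> carrier G" and W: "W \<subseteq> {v, \<one>}" and x: "x \<in> generate G W" and y: "y \<in> generate G W"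
  shows "x \<otimes> y = y \<otimes> x"
proof -
  have sub: "subgroup (generate G {v}) G" using v by (intro generate_is_subgroup) simp
  have "W \<subseteq> generate G {v}" using W generate.incl[of v "{v}" G] generate.one[of G "{v}"] by blast
  then have "generate G W \<subseteq> generate G {v}"
    by (intro generate_subgroup_incl sub)
  then have "\<exists>j :: int. x = v [^] j" "\<exists>k :: int. y = v [^] k"
    using x y generate_pow[OF v] by blast+
  then obtain j k :: int where "x = v [^] j" "y = v [^] k" by blast
  then show ?thesis using v by (simp add: int_pow_mult[symmetric] add.commute)
qed

lemma (in group) group_rank_eq_2:
  assumes a: "a \<in> carrier G" and y: "y \<in> carrier G" and gen: "generate G {a, y} = carrier G"
    and nc: "a \<otimes> y \<noteq> y \<otimes> a"
  shows "group_rank G = 2"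
  unfolding group_rank_def
proof (rule Least_equality)
  have "a \<noteq> y" using nc by auto
  then show "\<exists>S\<subseteq>carrier G. finite S \<and> card S = 2 \<and> generate G S = carrier G"
    using a y gen by (intro exI[of _ "{a, y}"]) auto
next
  fix n assume "\<exists>S\<subseteq>carrier G. finite S \<and> card S = n \<and> generate G S = carrier G"
  then obtain S where S: "S \<subseteq> carrier G" "finite S" "card S = n" "generate G S = carrier G" by blast
  show "2 \<le> n"
  proof (rule ccontr)
    assume "\<not> 2 \<le> n"
    then have "card S = 0 \<or> card S = 1" using S(3) by auto
    then obtain v where "v \<in> carrier G" "S \<subseteq> {v, \<one>}"
      using S(1,2) by (auto simp: card_1_singleton_iff)
    from generate_with_one_commute[OF this] nc S(4) a y show False by metis
  qed
qed

text \<open>The images of \<open>tri_A\<close> and \<open>tri_Y\<close> under \<open>z \<mapsto> 2\<close>, read modulo \<open>2 ^ p - 1\<close>, after forgetting all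
  entries but the first and the last.\<close>

definition aff_A :: "nat \<Rightarrow> int tri" where
  "aff_A i = (if i = 0 then (2, 1, 0, 0, 0) else (2 ^ i, 1, 0, 0, 0))"

definition aff_Y :: "nat \<Rightarrow> nat \<Rightarrow> int tri" where
  "aff_Y p i = (if i = 0 then (1, 1, 0, 0, - 9) else (2 ^ (p - 1), 1, 0, 0, 1))"

text \<open>For s = 0 the corner entry of a product involves only the first and last entries of the
  factors, so this projection to the affine maps v \<mapsto> d v + z is multiplicative.\<close>

fun aff_part :: "'r::comm_ring_1 tri \<Rightarrow> 'r tri" where
  "aff_part (d, e, x, y, z) = (d, 1, 0, 0, z)"

lemma tri_cong_fst: "tri_cong I t u \<Longrightarrow> icong I (fst t) (fst u)"
  by (cases t; cases u) simp

section \<open>Affine quotients modulo 2^p - 1 and generation by torsion elements\<close>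

locale aff_quotients = group G for G (structure) +
  fixes p :: nat and a y :: 'a and \<kappa> :: "nat \<Rightarrow> 'a \<Rightarrow> int tri"
  assumes p: "Factorial_Ring.prime p" "odd p"
    and a: "a \<in> carrier G" and y: "y \<in> carrier G" and gen: "generate G {a, y} = carrier G"
    and hom: "i < p \<Longrightarrow> \<kappa> i \<in> hom G (tri_group (multiples (2 ^ p - 1)) 0)"
    and \<kappa>_a: "i < p \<Longrightarrow> \<kappa> i a = tri_rep (multiples (2 ^ p - 1)) (aff_A i)"
    and \<kappa>_y: "i < p \<Longrightarrow> \<kappa> i y = tri_rep (multiples (2 ^ p - 1)) (aff_Y p i)"
begin

abbreviation "M \<equiv> 2 ^ p - 1 :: int"
abbreviation "I \<equiv> multiples M"
abbreviation "T \<equiv> tri_group I 0"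

lemma I: "ideal_set I"
  by (rule ideal_multiples)

lemmas T_group = tri_group[OF I]

lemmas [trans] = icong_trans[OF I]

lemma p_ge_3: "3 \<le> p"
  using p prime_ge_2_nat[of p] by (cases "p = 2") auto

definition lin :: "nat \<Rightarrow> 'a \<Rightarrow> int" where "lin i g = fst (\<kappa> i g)"
definition tr :: "nat \<Rightarrow> 'a \<Rightarrow> int" where "tr i g = snd (snd (snd (snd (\<kappa> i g))))"

lemma group_hom_\<kappa>: "i < p \<Longrightarrow> group_hom G T (\<kappa> i)"
  by (intro group_hom.intro group_hom_axioms.intro is_group T_group hom)

lemma lin_tr_mult:
  assumes "i < p" "g \<in> carrier G" "h \<in> carrier G"
  shows "icong I (lin i (g \<otimes> h)) (lin i g * lin i h)"
    and "icong I (tr i (g \<otimes> h)) (lin i g * tr i h + tr i g)"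
proof -
  have "\<kappa> i (g \<otimes> h) = tri_rep I (tri_mult 0 (\<kappa> i g) (\<kappa> i h))"
    using hom[OF assms(1)] assms(2,3) by (simp add: hom_def mult_tri_group)
  then have "tri_cong I (\<kappa> i (g \<otimes> h)) (tri_mult 0 (\<kappa> i g) (\<kappa> i h))"
    using tri_cong_sym[OF I tri_rep_cong[OF I]] by metis
  then show "icong I (lin i (g \<otimes> h)) (lin i g * lin i h)"
    and "icong I (tr i (g \<otimes> h)) (lin i g * tr i h + tr i g)"
    by (cases "\<kappa> i g"; cases "\<kappa> i h"; cases "\<kappa> i (g \<otimes> h)"; simp add: lin_def tr_def)+
qed

lemma lin_tr_one:
  assumes "i < p"
  shows "icong I (lin i \<one>) 1" and "icong I (tr i \<one>) 0"
proof -
  have "\<kappa> i \<one> = tri_rep I tri_one"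
    using group_hom.hom_one[OF group_hom_\<kappa>[OF assms]] by (simp add: one_tri_group)
  then have "tri_cong I (\<kappa> i \<one>) tri_one"
    using tri_cong_sym[OF I tri_rep_cong[OF I]] by metis
  then show "icong I (lin i \<one>) 1" and "icong I (tr i \<one>) 0"
    by (cases "\<kappa> i \<one>"; simp add: lin_def tr_def tri_one_def)+
qed

lemma two_pow_p: "icong I (2 ^ (p * k)) 1"
proof -
  have "icong I (2 ^ p) 1" by (simp add: icong_multiples)
  from icong_power[OF I this, of k] show ?thesis by (simp add: power_mult)
qed

text \<open>As 2^p is 1 modulo \<open>M\<close>, the factor p - 1 acts on exponents as -1, which
  keeps all exponents natural numbers.\<close>

lemma lin_inv:
  assumes i: "i < p" and g: "g \<in> carrier G" and n: "icong I (lin i g) (2 ^ n)"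
  shows "icong I (lin i (inv g)) (2 ^ ((p - 1) * n))"
proof -
  have "p * n = n + (p - 1) * n" using p_ge_3 by (cases p) auto
  then have pn: "(2::int) ^ (p * n) = 2 ^ n * 2 ^ ((p - 1) * n)" by (simp add: power_add)
  have "icong I (lin i (inv g) * lin i g) (lin i \<one>)"
    using icong_sym[OF I lin_tr_mult(1)[OF i inv_closed[OF g] g]] g by simp
  also have "icong I (lin i \<one>) 1" by (rule lin_tr_one(1)[OF i])
  finally have "icong I (lin i (inv g) * lin i g) 1" .
  then have "icong I (lin i (inv g) * lin i g * 2 ^ ((p - 1) * n)) (1 * 2 ^ ((p - 1) * n))"
    by (intro icong_mult icong_refl I)
  then have *: "icong I (lin i (inv g) * (lin i g * 2 ^ ((p - 1) * n))) (2 ^ ((p - 1) * n))"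
    by (simp add: mult.assoc)
  have "icong I (lin i (inv g) * 2 ^ (p * n)) (lin i (inv g) * 1)"
    by (intro icong_mult icong_refl I two_pow_p)
  then have "icong I (lin i (inv g)) (lin i (inv g) * (2 ^ n * 2 ^ ((p - 1) * n)))"
    unfolding pn by (simp add: icong_sym[OF I])
  also have "icong I (lin i (inv g) * (2 ^ n * 2 ^ ((p - 1) * n))) (lin i (inv g) * (lin i g * 2 ^ ((p - 1) * n)))"
    by (intro icong_mult icong_refl I icong_sym[OF I n])
  also note *
  finally show ?thesis .
qed

text \<open>Here \<open>e\<close> and \<open>f\<close> stand for the exponent sums of
  \<open>a\<close> and \<open>y\<close>, relevant only modulo \<open>p\<close>; the second condition
  encodes the linear part 2^(i e - f). It is a relation because an element may be written as a word
  in several ways.\<close>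

definition exponents :: "'a \<Rightarrow> nat \<Rightarrow> nat \<Rightarrow> bool" where
  "exponents g e f \<longleftrightarrow> icong I (lin 0 g) (2 ^ e) \<and> (\<forall>i\<in>{1..<p}. icong I (lin i g) (2 ^ (i * e + (p - 1) * f)))"

text \<open>With c = 1 this yields exponents for every element of the group; with c = p it
  propagates divisibility of \<open>f\<close> from a hypothetical pair of torsion
  generators.\<close>

lemma exponents_generate:
  assumes S: "S \<subseteq> carrier G" and base: "\<And>s. s \<in> S \<Longrightarrow> \<exists>e f. c dvd f \<and> exponents s e f"
    and g: "g \<in> generate G S"
  shows "\<exists>e f. c dvd f \<and> exponents g e f"
  using g
proof (induction g rule: generate.induct)
  case one
  show ?case using lin_tr_one(1) p_ge_3
    by (intro exI[of _ 0] exI[of _ 0]) (auto simp: exponents_def)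
next
  case (incl h)
  then show ?case by (rule base)
next
  case (inv h)
  then have h: "h \<in> carrier G" using S by blast
  obtain e f where ef: "c dvd f" "exponents h e f" using base inv by blast
  have "icong I (lin 0 (inv h)) (2 ^ ((p - 1) * e))"
    using lin_inv[OF _ h, of 0 e] ef p_ge_3 by (simp add: exponents_def)
  moreover have "icong I (lin i (inv h)) (2 ^ (i * ((p - 1) * e) + (p - 1) * ((p - 1) * f)))" if "i \<in> {1..<p}" for i
  proof -
    have "(p - 1) * (i * e + (p - 1) * f) = i * ((p - 1) * e) + (p - 1) * ((p - 1) * f)"
      by (simp only: distrib_left mult.left_commute)
    then show ?thesis
      using lin_inv[OF _ h, of i "i * e + (p - 1) * f"] ef that unfolding exponents_def by simp
  qed
  ultimately have "exponents (inv h) ((p - 1) * e) ((p - 1) * f)" by (simp add: exponents_def)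
  then show ?case using ef(1) by (metis dvd_mult)
next
  case (eng h1 h2)
  then have h: "h1 \<in> carrier G" "h2 \<in> carrier G" using generate_in_carrier[OF S] by auto
  obtain e1 f1 e2 f2 where ef: "c dvd f1" "exponents h1 e1 f1" "c dvd f2" "exponents h2 e2 f2" using eng by blast
  have *: "icong I (lin i (h1 \<otimes> h2)) (2 ^ (n1 + n2))"
    if "i < p" "icong I (lin i h1) (2 ^ n1)" "icong I (lin i h2) (2 ^ n2)" for i n1 n2
    using icong_trans[OF I lin_tr_mult(1)[OF that(1) h] icong_mult[OF I that(2,3)]]
    by (simp add: power_add)
  have "icong I (lin i (h1 \<otimes> h2)) (2 ^ (i * (e1 + e2) + (p - 1) * (f1 + f2)))" if "i \<in> {1..<p}" for i
  proof -
    have "i * (e1 + e2) + (p - 1) * (f1 + f2) = (i * e1 + (p - 1) * f1) + (i * e2 + (p - 1) * f2)"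
      by (simp only: distrib_left add_ac)
    then show ?thesis
      using *[of i "i * e1 + (p - 1) * f1" "i * e2 + (p - 1) * f2"] ef that unfolding exponents_def by simp
  qed
  then have "exponents (h1 \<otimes> h2) (e1 + e2) (f1 + f2)"
    using ef *[of 0 e1 e2] p_ge_3 by (simp add: exponents_def)
  then show ?case using ef by (metis dvd_add)
qed

lemma aff_hom:
  assumes i: "i < p"
  shows "(\<lambda>g. tri_rep I (aff_part (\<kappa> i g))) \<in> hom G T"
    and "tri_rep I (aff_part (\<kappa> i a)) = tri_rep I (aff_A i)"
    and "tri_rep I (aff_part (\<kappa> i y)) = tri_rep I (aff_Y p i)"
proof -
  have F_mult: "aff_part (tri_mult 0 t u) = tri_mult 0 (aff_part t) (aff_part u)" for t u :: "int tri"
    by (cases t; cases u) simp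
  have F_one: "aff_part tri_one = (tri_one :: int tri)" by (simp add: tri_one_def)
  have F_cong: "tri_cong I (aff_part t) (aff_part u)" if "tri_cong I t u" for t u
    using that by (cases t; cases u) (auto intro: icong_refl[OF I])
  note * = tri_hom[OF I I F_mult F_one F_cong]
  show "(\<lambda>g. tri_rep I (aff_part (\<kappa> i g))) \<in> hom G T"
    using Group.hom_compose[OF hom[OF i] *(1)] by (simp add: comp_def)
  show "tri_rep I (aff_part (\<kappa> i a)) = tri_rep I (aff_A i)"
    "tri_rep I (aff_part (\<kappa> i y)) = tri_rep I (aff_Y p i)"
    using *(2) by (simp_all add: \<kappa>_a[OF i] \<kappa>_y[OF i] aff_A_def aff_Y_def)
qed

lemma M_not_dvd:
  assumes "0 < i" "i < p"
  shows "\<not> M dvd 2 ^ i - 1"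
proof
  assume "M dvd 2 ^ i - 1"
  moreover have "(1::int) < 2 ^ i" using assms by simp
  ultimately have "M \<le> 2 ^ i - 1" by (intro zdvd_imp_le) auto
  moreover have "(2::int) ^ i < 2 ^ p" using assms by simp
  ultimately show False by simp
qed

text \<open>The number -9 is the corner entry of \<open>tri_Y\<close> for i = 0 at z = 2. For p = 3
  the modulus is 7, and for larger \<open>p\<close> it exceeds 9.\<close>

lemma M_not_dvd_9: "\<not> M dvd 9"
proof
  assume *: "M dvd 9"
  show False
  proof (cases "p = 3")
    case False
    then have "p \<ge> 5" using p_ge_3 p(2) by (cases "p = 4") auto
    then have "(2::int) ^ 5 \<le> 2 ^ p" by (intro power_increasing) auto
    moreover have "M \<le> 9" using * by (rule zdvd_imp_le) simp
    ultimately show False by simp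
  qed (use * in simp)
qed

text \<open>The corner entries of the two products differ by -9 for i = 0 and by 2^i - 1
  otherwise.\<close>

lemma aff_not_commute:
  assumes i: "i < p"
  shows "tri_rep I (aff_A i) \<otimes>\<^bsub>T\<^esub> tri_rep I (aff_Y p i) \<noteq> tri_rep I (aff_Y p i) \<otimes>\<^bsub>T\<^esub> tri_rep I (aff_A i)"
proof (cases "i = 0")
  case True
  have "\<not> M dvd - 9" using M_not_dvd_9 by simp
  then show ?thesis
    by (simp add: True aff_A_def aff_Y_def mult_tri_rep[OF I] tri_rep_eq_iff[OF I] icong_multiples del: tri_rep.simps)
next
  case False
  then show ?thesis using M_not_dvd[OF _ i]
    by (simp add: aff_A_def aff_Y_def mult_tri_rep[OF I] tri_rep_eq_iff[OF I] icong_multiples del: tri_rep.simps)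
qed

lemma not_commute: "a \<otimes> y \<noteq> y \<otimes> a"
proof
  assume "a \<otimes> y = y \<otimes> a"
  moreover have "0 < p" using p_ge_3 by simp
  ultimately show False
    using aff_not_commute[of 0] aff_hom[of 0] a y unfolding hom_def by (simp del: tri_rep.simps) metis
qed

lemma rank: "group_rank G = 2"
  by (rule group_rank_eq_2[OF a y gen not_commute])

text \<open>An element with linear part 1 acts as a translation, its p^r-th power as p^r times that
  translation, and \<open>p\<close> is invertible modulo \<open>M\<close>.\<close>

lemma torsion_trivial:
  assumes i: "i < p" and W: "W \<in> carrier G" "W [^] (p ^ r) = \<one>" and lin: "icong I (lin i W) 1"
  shows "tri_rep I (aff_part (\<kappa> i W)) = \<one>\<^bsub>T\<^esub>"
proof -
  have *: "icong I (lin i (W [^] j)) 1 \<and> icong I (tr i (W [^] j)) (int j * tr i W)" for j :: nat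
  proof (induction j)
    case 0
    then show ?case using lin_tr_one[OF i] by simp
  next
    case (Suc j)
    have "icong I (lin i (W [^] j) * lin i W) (1 * 1)"
      using Suc lin by (intro icong_mult I) auto
    moreover have "icong I (lin i (W [^] j) * tr i W + tr i (W [^] j)) (1 * tr i W + int j * tr i W)"
      using Suc by (intro icong_add icong_mult icong_refl I) auto
    ultimately show ?case
      using icong_trans[OF I lin_tr_mult(1)[OF i _ W(1), of "W [^] j"]]
        icong_trans[OF I lin_tr_mult(2)[OF i _ W(1), of "W [^] j"]] W(1)
      by (simp add: distrib_right)
  qed
  have "icong I (int (p ^ r) * tr i W) (tr i (W [^] (p ^ r)))"
    using *[of "p ^ r"] icong_sym[OF I] by blast
  also have "icong I (tr i (W [^] (p ^ r))) 0"
    using lin_tr_one(2)[OF i] W(2) by simp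
  finally have "icong I (int (p ^ r) * tr i W) 0" .
  then have "M dvd int p ^ r * tr i W" by (simp add: icong_multiples)
  then have "M dvd tr i W"
    using coprime_two_power_minus_one[OF p, of r] by (simp add: coprime_dvd_mult_right_iff)
  then show ?thesis using lin
    by (cases "\<kappa> i W") (simp add: one_tri_group rep_eq_iff[OF I] icong_multiples tri_one_def lin_def tr_def)
qed

text \<open>Modulo \<open>p\<close>, every pair (e, f) is killed by one of the characters e and i e
  - f with 0 < i < p, except when f = 0 and e \<noteq> 0. A torsion generator killed by a character
  would leave a non-abelian quotient generated by one element. So both generators have
  \<open>p dvd f\<close>, which fails for \<open>y\<close>.\<close>

lemma not_generated_by_torsion:
  assumes U: "U \<in> carrier G" "U [^] (p ^ u) = \<one>" and V: "V \<in> carrier G" "V [^] (p ^ v) = \<one>"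
  shows "generate G {U, V} \<noteq> carrier G"
proof
  assume gUV: "generate G {U, V} = carrier G"
  have no_kernel: False if i: "i < p" and W: "W \<in> {U, V}" and lin: "icong I (lin i W) 1" for i W
  proof -
    define h where "h = (\<lambda>g. tri_rep I (aff_part (\<kappa> i g)))"
    interpret h: group_hom G T h
      unfolding h_def by (intro group_hom.intro group_hom_axioms.intro is_group T_group aff_hom[OF i])
    have "h W = \<one>\<^bsub>T\<^esub>"
      using W torsion_trivial[OF i U _] torsion_trivial[OF i V _] lin unfolding h_def by auto
    then have "h ` {U, V} \<subseteq> {h U, \<one>\<^bsub>T\<^esub>} \<or> h ` {U, V} \<subseteq> {h V, \<one>\<^bsub>T\<^esub>}"
      using W by blast
    then obtain v where v: "v \<in> carrier T" "h ` {U, V} \<subseteq> {v, \<one>\<^bsub>T\<^esub>}"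
      using h.hom_closed[OF U(1)] h.hom_closed[OF V(1)] by metis
    have "h ` carrier G = generate T (h ` {U, V})"
      using h.generate_img[of "{U, V}"] U V gUV by simp
    then have "h a \<in> generate T (h ` {U, V})" "h y \<in> generate T (h ` {U, V})" using a y by blast+
    from h.H.generate_with_one_commute[OF v this] aff_not_commute[OF i] aff_hom(2,3)[OF i]
    show False by (simp add: h_def del: tri_rep.simps)
  qed
  have exponents_ay: "\<exists>e f. 1 dvd f \<and> exponents s e f" if "s \<in> {a, y}" for s
  proof -
    have "tri_cong I (\<kappa> i a) (aff_A i)" "tri_cong I (\<kappa> i y) (aff_Y p i)" if "i < p" for i
      using that tri_cong_sym[OF I tri_rep_cong[OF I]] by (simp_all add: \<kappa>_a \<kappa>_y)
    then have lin: "icong I (lin i a) (fst (aff_A i))" "icong I (lin i y) (fst (aff_Y p i))" if "i < p" for i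
      using that tri_cong_fst unfolding lin_def by blast+
    have "icong I (lin i a) (2 ^ i)" "icong I (lin i y) (2 ^ (p - 1))" if "i \<in> {1..<p}" for i
      using lin[of i] that by (simp_all add: aff_A_def aff_Y_def)
    moreover have "icong I (lin 0 a) 2" "icong I (lin 0 y) 1"
      using lin[of 0] p_ge_3 by (simp_all add: aff_A_def aff_Y_def)
    ultimately have "exponents a 1 0" "exponents y 0 1"
      by (simp_all add: exponents_def)
    then show ?thesis using that by auto
  qed
  have exps: "\<exists>e f. exponents g e f" if "g \<in> carrier G" for g
    using exponents_generate[of "{a, y}" 1 g, OF _ exponents_ay] that a y gen by auto
  have lin1: "icong I (lin i g) 1" if "icong I (lin i g) (2 ^ n)" "p dvd n" for i g n
    using that two_pow_p icong_trans[OF I] by (auto elim!: dvdE)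
  have f_dvd: "p dvd f" if W: "W \<in> {U, V}" and ef: "exponents W e f" for W e f
  proof (rule ccontr)
    assume f: "\<not> p dvd f"
    have e: "\<not> p dvd e"
      using no_kernel[OF _ W, of 0] lin1[of 0 W e] ef p_ge_3 by (auto simp: exponents_def)
    \<comment> \<open>\<open>x\<close> inverts \<open>e\<close> modulo \<open>p\<close>, so
      \<open>i\<close> represents f / e: this is the character that kills the pair, and i is nonzero
      because \<open>p\<close> divides neither \<open>f\<close> nor \<open>x\<close>.\<close>
    obtain x z where xz: "e * x = Suc (p * z)" using bezout_prime[OF p(1) e] by blast
    define i where "i = (f * x) mod p"
    have "\<not> p dvd x"
    proof
      assume "p dvd x"
      then have "p dvd Suc (p * z)" unfolding xz[symmetric] by simp
      then have "p dvd 1" using dvd_add_right_iff[of p "p * z" 1] by simp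
      then show False using p_ge_3 by simp
    qed
    then have "\<not> p dvd f * x" using f p(1) prime_dvd_mult_iff by blast
    then have i: "i \<in> {1..<p}" using p_ge_3 by (auto simp: i_def dvd_eq_mod_eq_0)
    have "(i * e + (p - 1) * f) mod p = (f * x * e + (p - 1) * f) mod p"
      by (metis i_def mod_add_left_eq mod_mult_left_eq)
    also have "f * x * e + (p - 1) * f = f * (e * x) + (p - 1) * f" by (simp add: algebra_simps)
    also have "\<dots> = p * (f * z + f)"
      unfolding xz using p_ge_3 by (cases p) (simp_all add: algebra_simps)
    finally have "p dvd i * e + (p - 1) * f" by (simp add: dvd_eq_mod_eq_0)
    then have "icong I (lin i W) 1" using ef i by (intro lin1[of i W "i * e + (p - 1) * f"]) (auto simp: exponents_def)
    then show False using no_kernel[OF _ W] i by auto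
  qed
  have "\<exists>e f. p dvd f \<and> exponents y e f"
  proof (rule exponents_generate)
    show "{U, V} \<subseteq> carrier G" "y \<in> generate G {U, V}" using U V y gUV by auto
    show "\<exists>e f. p dvd f \<and> exponents s e f" if "s \<in> {U, V}" for s
      using that exps[of s] f_dvd[OF that] U V by auto
  qed
  then obtain e f where f: "p dvd f" and ef: "exponents y e f" by blast
  \<comment> \<open>With \<open>p dvd f\<close> the linear parts of \<open>y\<close> in the
    quotients 0 and 1 would both be 2^e, but they are 1 and 2^(p - 1), the inverse of 2.\<close>
  have y: "tri_cong I (\<kappa> i y) (aff_Y p i)" if "i < p" for i
    using that tri_cong_sym[OF I tri_rep_cong[OF I]] by (simp add: \<kappa>_y)
  have y01: "icong I (lin 0 y) 1" "icong I (lin 1 y) (2 ^ (p - 1))"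
    using y[of 0] y[of 1] p_ge_3 by (cases "\<kappa> 0 y"; cases "\<kappa> 1 y"; auto simp: lin_def aff_Y_def)+
  have "icong I (2 ^ (p - 1)) (lin 1 y)" by (rule icong_sym[OF I y01(2)])
  also have "icong I (lin 1 y) (2 ^ e * 2 ^ ((p - 1) * f))"
    using bspec[OF conjunct2[OF ef[unfolded exponents_def]], of 1] p_ge_3 by (simp add: power_add)
  also have "icong I (2 ^ e * 2 ^ ((p - 1) * f)) (2 ^ e * 1)"
    using f two_pow_p by (intro icong_mult icong_refl I) (auto elim!: dvdE simp: mult.left_commute)
  also have "2 ^ e * 1 = (2 ^ e :: int)" by simp
  also have "icong I (2 ^ e) (lin 0 y)" using ef icong_sym[OF I] by (simp add: exponents_def)
  also note y01(1)
  finally have "icong I (2 ^ (p - 1)) 1" .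
  then show False using M_not_dvd[of "p - 1"] p_ge_3 by (simp add: icong_multiples)
qed

lemma not_iso_free_prod:
  assumes "0 < l" "0 < k"
  shows "\<not> G \<cong> free_prod_cyclic (p ^ l) (p ^ k)"
proof
  interpret F: free_prod "p ^ l" "p ^ k"
    using assms p_ge_3 by unfold_locales (auto intro: order_trans[OF _ self_le_power])
  assume "G \<cong> F.\<F>"
  then obtain h where h: "h \<in> iso F.\<F> G"
    using iso_sym F.group_F by (auto simp: is_iso_def)
  interpret h: group_hom F.\<F> G h
    using h by (intro group_hom.intro group_hom_axioms.intro F.group_F is_group) (simp add: iso_def)
  have "generate G (h ` {F.gen1, F.gen2}) = h ` carrier F.\<F>"
    using h.generate_img[of "{F.gen1, F.gen2}"] F.gen_in_F F.generate_F by simp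
  also have "\<dots> = carrier G" using h by (simp add: iso_def bij_betw_def)
  finally have "generate G {h F.gen1, h F.gen2} = carrier G" by simp
  moreover have "h F.gen1 [^] (p ^ l) = \<one>" "h F.gen2 [^] (p ^ k) = \<one>"
    using h.hom_nat_pow[OF F.gen_in_F(1), of "p ^ l"] h.hom_nat_pow[OF F.gen_in_F(2), of "p ^ k"] F.gen_pow h.hom_one
    by metis+
  ultimately show False
    using not_generated_by_torsion F.gen_in_F h.hom_closed by blast
qed

end

section \<open>The two groups\<close>

lemma monic_division:
  fixes f q :: "'r::comm_ring_1 poly"
  assumes q: "lead_coeff q = 1" "0 < Polynomial.degree q"
  shows "\<exists>v r. f = q * v + r \<and> Polynomial.degree r < Polynomial.degree q"
proof (induction f)
  case 0
  show ?case using q by (intro exI[of _ 0]) simp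
next
  case (pCons a f)
  then obtain v r where f: "f = q * v + r" and r: "Polynomial.degree r < Polynomial.degree q" by blast
  define c where "c = Polynomial.coeff (pCons a r) (Polynomial.degree q)"
  have "Polynomial.degree (pCons a r - smult c q) < Polynomial.degree q"
  proof (rule degree_lessI)
    show "\<forall>k\<ge>Polynomial.degree q. Polynomial.coeff (pCons a r - smult c q) k = 0"
    proof (intro allI impI)
      fix k assume k: "k \<ge> Polynomial.degree q"
      show "Polynomial.coeff (pCons a r - smult c q) k = 0"
      proof (cases "k = Polynomial.degree q")
        case False
        then have "Polynomial.degree q < k" "Polynomial.degree (pCons a r) < k"
          using k r degree_pCons_le[of a r] by auto
        then show ?thesis by (simp add: coeff_eq_0)
      qed (use q in \<open>simp add: c_def\<close>)
    qed
  qed (use q in simp)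
  moreover have "pCons a f = q * (pCons c v) + (pCons a r - smult c q)"
    by (simp add: f)
  ultimately show ?case by blast
qed

lemma monic_dvd_degree_less:
  fixes f q :: "int poly"
  assumes "q dvd f" "Polynomial.degree f < Polynomial.degree q"
  shows "f = 0"
  using assms dvd_imp_degree_le by fastforce

text \<open>Modulo \<open>q\<close>, (x - 1)^p is a multiple of \<open>p\<close>. Thus an element of
  all the power ideals has a remainder modulo \<open>q\<close> divisible by every power of
  \<open>p\<close>, and an integer polynomial with this property is zero.\<close>

lemma power_ideals_Inter:
  fixes f :: "int poly"
  assumes p: "Factorial_Ring.prime p" "odd p"
  defines "q \<equiv> [:0, 1:] ^ p - 1"
  assumes f: "\<And>k. f \<in> power_ideal ([:0, 1:] - 1) q k"
  shows "f \<in> multiples q"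
proof -
  define \<xi> where "\<xi> = [:0, 1 :: int:]"
  define \<pi> where "\<pi> = \<xi> - 1"
  have I: "ideal_set (multiples q)" by (rule ideal_multiples)
  have p0: "0 < p" using p(1) by (simp add: prime_gt_0_nat)
  have \<xi>p: "\<xi> ^ p = Polynomial.monom 1 p" by (simp add: \<xi>_def monom_altdef)
  have deg: "Polynomial.degree q = p"
    unfolding q_def \<xi>_def[symmetric] \<xi>p diff_conv_add_uminus using p0
    by (subst degree_add_eq_left) (simp_all add: degree_monom_eq)
  have lc: "lead_coeff q = 1"
    unfolding deg using p0 by (simp add: q_def \<xi>_def[symmetric] \<xi>p)
  note div = monic_division[OF lc, unfolded deg, OF p0]
  obtain v r where fr: "f = q * v + r" and r: "Polynomial.degree r < p" using div by blast
  obtain h where h: "(\<xi> - 1) ^ p - (\<xi> ^ p - 1) = of_nat p * h"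
    using prime_power_minus_one[OF p, of \<xi>] by (auto simp: dvd_def)
  have *: "icong (multiples q) (\<pi> ^ p) (of_nat p * h)"
    using h by (intro icong_multiplesI[where c = 1]) (simp add: \<pi>_def q_def \<xi>_def algebra_simps)
  have r_dvd: "\<exists>s. r = of_nat (p ^ N) * s" for N
  proof -
    obtain u w where uw: "f = u * \<pi> ^ (p * N) + w * q"
      using f[of "p * N"] by (auto simp: power_ideal_def \<pi>_def \<xi>_def)
    \<comment> \<open>Reducing the cofactor u h^N as well keeps the degree below that of
      \<open>q\<close>, so the congruence between \<open>r\<close> and p^N s becomes an
      equality.\<close>
    obtain v1 s where s: "u * h ^ N = q * v1 + s" "Polynomial.degree s < p" using div by blast
    have "icong (multiples q) (u * \<pi> ^ (p * N)) (u * (of_nat p * h) ^ N)"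
      using icong_power[OF I *, of N] by (intro icong_mult icong_refl I) (simp add: power_mult)
    then obtain w1 where w1: "u * \<pi> ^ (p * N) - u * (of_nat p * h) ^ N = q * w1"
      by (auto simp: icong_multiples dvd_def)
    have "r - of_nat (p ^ N) * s = (f - q * v) - of_nat (p ^ N) * (u * h ^ N - q * v1)"
      by (simp add: fr s)
    also have "\<dots> = (u * \<pi> ^ (p * N) - u * (of_nat p * h) ^ N) + q * (w - v + of_nat (p ^ N) * v1)"
      by (simp add: uw algebra_simps power_mult_distrib)
    also have "\<dots> = q * (w1 + (w - v + of_nat (p ^ N) * v1))"
      by (simp only: w1 distrib_left)
    finally have "q dvd r - of_nat (p ^ N) * s" by (rule dvdI)
    moreover have "Polynomial.degree (of_nat (p ^ N) * s) < p"
      using s(2) unfolding of_nat_poly by simp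
    then have "Polynomial.degree (r - of_nat (p ^ N) * s) < Polynomial.degree q"
      using r deg degree_diff_less by metis
    ultimately show ?thesis
      using monic_dvd_degree_less by (metis eq_iff_diff_eq_0)
  qed
  have "Polynomial.coeff r i = 0" for i
  proof (rule ccontr)
    assume nz: "Polynomial.coeff r i \<noteq> 0"
    \<comment> \<open>Any N with p^N larger than the absolute value of the coefficient would do; the
      absolute value itself works since N < p^N.\<close>
    define N where "N = nat \<bar>Polynomial.coeff r i\<bar>"
    obtain s where "r = of_nat (p ^ N) * s" using r_dvd by blast
    then have "Polynomial.coeff r i = int (p ^ N) * Polynomial.coeff s i"
      by (simp add: of_nat_poly)
    then have "int (p ^ N) \<le> \<bar>Polynomial.coeff r i\<bar>"
      using nz by (intro zdvd_imp_le) auto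
    moreover have "2 \<le> p" using p(1) prime_ge_2_nat by blast
    then have "N < p ^ N"
      using order_less_le_trans[OF less_exp[of N] power_mono[of 2 p N]] by simp
    moreover have "\<bar>Polynomial.coeff r i\<bar> = int N" by (simp add: N_def)
    ultimately show False by (simp only: of_nat_le_iff)
  qed
  then have "r = 0" by (simp add: poly_eq_iff)
  then show ?thesis by (simp add: fr multiples_def)
qed

text \<open>A subgroup with two generators is countable, being the set of values of words, so it can
  be transported to a carrier of natural numbers.\<close>

lemma countable_copy:
  fixes P :: "('a, 'b) monoid_scheme"
  assumes "group P" and a: "a \<in> carrier P" and y: "y \<in> carrier P"
  obtains G :: "nat monoid" and \<psi> a' y'
  where "group G" "\<psi> \<in> hom G P" "inj_on \<psi> (carrier G)" "a' \<in> carrier G" "y' \<in> carrier G"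
    "\<psi> a' = a" "\<psi> y' = y" "generate G {a', y'} = carrier G"
proof -
  interpret P: group P by fact
  define S where "S = generate P {a, y}"
  interpret S: subgroup S P unfolding S_def using a y by (intro P.generate_is_subgroup) auto
  \<comment> \<open>A letter is a pair of booleans: the first selects the generator, the second its
    sign.\<close>
  define l :: "bool \<times> bool \<Rightarrow> 'a" where
    "l c = (let u = (if fst c then a else y) in if snd c then u else inv\<^bsub>P\<^esub> u)" for c
  define ev where "ev w = foldr (\<lambda>c u. l c \<otimes>\<^bsub>P\<^esub> u) w \<one>\<^bsub>P\<^esub>" for w
  have l: "l c \<in> carrier P" for c using a y by (simp add: l_def Let_def)
  have ev: "ev w \<in> carrier P" for w by (induction w) (auto simp: ev_def l)
  have ev_append: "ev (v @ w) = ev v \<otimes>\<^bsub>P\<^esub> ev w" for v w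
  proof (induction v)
    case (Cons c v)
    then show ?case using P.m_assoc[OF l ev ev] by (simp add: ev_def)
  next
    case Nil
    then show ?case using ev[of w] by (simp add: ev_def)
  qed
  have "u \<in> range ev" if "u \<in> S" for u
    using that unfolding S_def
  proof (induction u rule: generate.induct)
    case one
    have "\<one>\<^bsub>P\<^esub> = ev []" by (simp add: ev_def)
    then show ?case by blast
  next
    case (incl h)
    then have "h = ev [(h = a, True)]" using a y by (auto simp: ev_def l_def)
    then show ?case by blast
  next
    case (inv h)
    then have "inv\<^bsub>P\<^esub> h = ev [(h = a, False)]" using a y by (auto simp: ev_def l_def)
    then show ?case by blast
  next
    case (eng h1 h2)
    then obtain v w where "h1 = ev v" "h2 = ev w" by blast
    then have "h1 \<otimes>\<^bsub>P\<^esub> h2 = ev (v @ w)" by (simp add: ev_append)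
    then show ?case by blast
  qed
  then have cS: "countable S" by (meson countable_subset countable_image countableI_type subsetI)
  define f where "f = to_nat_on S"
  define \<psi> where "\<psi> = from_nat_into S"
  have \<psi>f: "\<psi> (f s) = s" if "s \<in> S" for s
    unfolding \<psi>_def f_def using cS that by (rule from_nat_into_to_nat_on)
  define G :: "nat monoid" where
    "G = \<lparr>carrier = f ` S, monoid.mult = (\<lambda>u v. f (\<psi> u \<otimes>\<^bsub>P\<^esub> \<psi> v)), one = f \<one>\<^bsub>P\<^esub>\<rparr>"
  have "group G"
  proof (rule groupI)
    fix x assume "x \<in> carrier G"
    then obtain s where s: "s \<in> S" "x = f s" by (auto simp: G_def)
    then show "\<exists>y\<in>carrier G. y \<otimes>\<^bsub>G\<^esub> x = \<one>\<^bsub>G\<^esub>"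
      by (intro bexI[of _ "f (inv\<^bsub>P\<^esub> s)"]) (auto simp: G_def \<psi>f)
  qed (auto simp: G_def \<psi>f P.m_assoc)
  moreover have hom: "\<psi> \<in> hom G P"
    by (auto simp: hom_def G_def \<psi>f)
  moreover have inj: "inj_on \<psi> (carrier G)"
    by (auto simp: inj_on_def G_def \<psi>f)
  moreover have in_S: "a \<in> S" "y \<in> S" by (auto simp: S_def intro: generate.incl)
  then have in_G: "f a \<in> carrier G" "f y \<in> carrier G" by (auto simp: G_def)
  moreover have "\<psi> (f a) = a" "\<psi> (f y) = y" using in_S \<psi>f by auto
  moreover have "generate G {f a, f y} = carrier G"
  proof -
    interpret \<psi>: group_hom G P \<psi>
      using \<open>group G\<close> hom by (intro group_hom.intro group_hom_axioms.intro) auto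
    have "\<psi> ` generate G {f a, f y} = S"
      using \<psi>.generate_img[of "{f a, f y}"] in_G in_S by (simp add: \<psi>f S_def)
    also have "S = \<psi> ` carrier G" using \<psi>f by (force simp: G_def)
    finally show ?thesis
      using inj \<psi>.G.generate_incl[of "{f a, f y}"] in_G by (meson inj_on_image_eq_iff empty_subsetI insert_subset subset_refl)
  qed
  ultimately show thesis by (rule that)
qed

section \<open>Subgroups of products: arguing by coordinates and modulo normal subgroups\<close>

lemma hom_from_product:
  assumes "\<psi> \<in> hom G (product_group J A \<times>\<times> B)"
  shows "j \<in> J \<Longrightarrow> (\<lambda>g. fst (\<psi> g) j) \<in> hom G (A j)" and "(\<lambda>g. snd (\<psi> g)) \<in> hom G B"
proof -
  have c: "fst (\<psi> g) \<in> (\<Pi>\<^sub>E j\<in>J. carrier (A j))" "snd (\<psi> g) \<in> carrier B" if "g \<in> carrier G" for g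
    using hom_in_carrier[OF assms that] by (auto simp: DirProd_def)
  have m: "fst (\<psi> (g \<otimes>\<^bsub>G\<^esub> h)) = (\<lambda>j\<in>J. fst (\<psi> g) j \<otimes>\<^bsub>A j\<^esub> fst (\<psi> h) j)"
    "snd (\<psi> (g \<otimes>\<^bsub>G\<^esub> h)) = snd (\<psi> g) \<otimes>\<^bsub>B\<^esub> snd (\<psi> h)"
    if "g \<in> carrier G" "h \<in> carrier G" for g h
    using hom_mult[OF assms that] by (auto simp: DirProd_def split_beta)
  show "(\<lambda>g. fst (\<psi> g) j) \<in> hom G (A j)" if "j \<in> J"
    using c(1) m(1) that by (intro homI) auto
  show "(\<lambda>g. snd (\<psi> g)) \<in> hom G B"
    using c(2) m(2) by (intro homI) auto
qed

lemma product_eqI: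
  assumes \<psi>: "\<psi> \<in> hom G (product_group J A \<times>\<times> B)" "inj_on \<psi> (carrier G)"
    and "g \<in> carrier G" "h \<in> carrier G"
    and "\<And>j. j \<in> J \<Longrightarrow> fst (\<psi> g) j = fst (\<psi> h) j" "snd (\<psi> g) = snd (\<psi> h)"
  shows "g = h"
proof -
  have c: "fst (\<psi> u) \<in> (\<Pi>\<^sub>E j\<in>J. carrier (A j))" if "u \<in> carrier G" for u
    using hom_in_carrier[OF \<psi>(1) that] by (auto simp: DirProd_def)
  have "fst (\<psi> g) = fst (\<psi> h)"
    by (rule PiE_ext[OF c[OF assms(3)] c[OF assms(4)] assms(5)])
  then have "\<psi> g = \<psi> h" using assms(6) by (simp add: prod_eq_iff)
  then show ?thesis using \<psi>(2) assms(3,4) by (auto dest: inj_onD)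
qed

text \<open>In the quotient by \<open>K\<close> the image of \<open>H\<close> is a subgroup, so it
  contains the image of everything generated by \<open>S\<close> once it contains the image of
  \<open>S\<close>.\<close>

lemma (in group) generate_mod_normal:
  assumes K: "K \<lhd> G" and H: "subgroup H G" and S: "S \<subseteq> carrier G"
    and base: "\<And>s. s \<in> S \<Longrightarrow> \<exists>h\<in>H. inv h \<otimes> s \<in> K"
    and g: "g \<in> generate G S"
  shows "\<exists>h\<in>H. inv h \<otimes> g \<in> K"
proof -
  interpret K: normal K G by fact
  interpret H: subgroup H G by fact
  interpret c: group_hom G "G Mod K" "\<lambda>x. K #> x" by (intro Mod_hom K)
  have eq: "K #> h = K #> s \<longleftrightarrow> inv h \<otimes> s \<in> K" if h: "h \<in> carrier G" and s: "s \<in> carrier G" for h s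
  proof -
    have one: "inv h \<otimes> s \<in> K \<longleftrightarrow> K #> (inv h \<otimes> s) = \<one>\<^bsub>G Mod K\<^esub>"
      using Mod_eq_one_iff[OF K.subgroup_axioms, of "inv h \<otimes> s"] h s by blast
    have m: "K #> (inv h \<otimes> s) = inv\<^bsub>G Mod K\<^esub> (K #> h) \<otimes>\<^bsub>G Mod K\<^esub> (K #> s)"
      by (simp only: c.hom_mult[OF inv_closed[OF h] s] c.hom_inv[OF h])
    have m': "K #> s = (K #> h) \<otimes>\<^bsub>G Mod K\<^esub> (K #> (inv h \<otimes> s))"
      using c.hom_mult[OF h m_closed[OF inv_closed[OF h] s]] mult_inv_mult[OF h s] by (simp only:)
    show ?thesis
    proof
      assume "K #> h = K #> s"
      then have "K #> (inv h \<otimes> s) = \<one>\<^bsub>G Mod K\<^esub>"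
        unfolding m using c.H.l_inv[OF c.hom_closed[OF s]] by (simp only:)
      then show "inv h \<otimes> s \<in> K" using one by blast
    next
      assume "inv h \<otimes> s \<in> K"
      then have o: "K #> (inv h \<otimes> s) = \<one>\<^bsub>G Mod K\<^esub>" using one by blast
      show "K #> h = K #> s"
        unfolding m' o by (rule c.H.r_one[OF c.hom_closed[OF h], symmetric])
    qed
  qed
  have "(\<lambda>x. K #> x) ` S \<subseteq> (\<lambda>x. K #> x) ` H"
  proof
    fix C assume "C \<in> (\<lambda>x. K #> x) ` S"
    then obtain s where s: "s \<in> S" "C = K #> s" by blast
    obtain h where h: "h \<in> H" "inv h \<otimes> s \<in> K" using base[OF s(1)] by blast
    have "K #> h = K #> s" using eq[of h s] h s(1) S by (meson H.mem_carrier subsetD)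
    then show "C \<in> (\<lambda>x. K #> x) ` H" using s(2) h(1) by (metis imageI)
  qed
  then have "(\<lambda>x. K #> x) ` generate G S \<subseteq> (\<lambda>x. K #> x) ` H"
    unfolding c.generate_img[OF S, symmetric]
    by (intro c.H.generate_subgroup_incl c.subgroup_img_is_subgroup H)
  then have "K #> g \<in> (\<lambda>x. K #> x) ` H" using g by (rule subsetD[OF _ imageI])
  then obtain h where h: "h \<in> H" "K #> g = K #> h" by (rule imageE)
  have gG: "g \<in> carrier G" using generate_in_carrier[OF S g] .
  have "inv h \<otimes> g \<in> K" using eq[OF H.mem_carrier[OF h(1)] gG] h(2)[symmetric] by (rule iffD1)
  then show ?thesis using h(1) by (rule bexI)
qed

lemma tri_cong_generate:
  assumes G: "group G" and I: "ideal_set I" and K: "ideal_set K" "I \<subseteq> K"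
    and \<theta>: "\<theta> \<in> hom G (tri_group I s)" and S: "S \<subseteq> carrier G"
    and base: "\<And>g. g \<in> S \<Longrightarrow> tri_cong K (\<theta> g) tri_one" and g: "g \<in> generate G S"
  shows "tri_cong K (\<theta> g) tri_one"
proof -
  have "tri_cong K t u" if "tri_cong I t u" for t u
    using that K(2) by (cases t; cases u) (auto simp: icong_def)
  note hom = tri_hom[OF I K(1), where F = "\<lambda>t. t" and s = s and s' = s, OF refl refl this]
  have "(\<lambda>g. tri_rep K (\<theta> g)) \<in> hom G (tri_group K s)"
    using Group.hom_compose[OF \<theta> hom(1)] by (simp add: comp_def)
  then interpret h: group_hom G "tri_group K s" "\<lambda>g. tri_rep K (\<theta> g)"
    by (intro group_hom.intro group_hom_axioms.intro G tri_group[OF K(1)])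
  have "S \<subseteq> kernel G (tri_group K s) (\<lambda>g. tri_rep K (\<theta> g))"
    using S base by (auto simp: kernel_def one_tri_group tri_rep_eq_iff[OF K(1)])
  then have "generate G S \<subseteq> kernel G (tri_group K s) (\<lambda>g. tri_rep K (\<theta> g))"
    by (intro h.G.generate_subgroup_incl h.subgroup_kernel)
  then show ?thesis using g by (auto simp: kernel_def one_tri_group tri_rep_eq_iff[OF K(1)])
qed

lemma (in group) pow_eq_one_dvd:
  "x \<in> carrier G \<Longrightarrow> x [^] p = \<one> \<Longrightarrow> p dvd n \<Longrightarrow> x [^] (n::nat) = \<one>"
proof -
  assume x: "x \<in> carrier G" "x [^] p = \<one>" and "p dvd n"
  then obtain j where "n = p * j" by (elim dvdE)
  then show "x [^] n = \<one>" using nat_pow_pow[OF x(1), of p j] x(2) by simp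
qed

text \<open>Identifies the image of \<open>b\<close> in each coordinate with the explicit matrix or
  coset known to satisfy the relation there.\<close>

lemma (in group) solve_relation_unique:
  assumes "y \<in> carrier G" "a \<in> carrier G" "b \<in> carrier G" "b' \<in> carrier G"
    and "y \<otimes> y \<otimes> b \<otimes> a = a \<otimes> y" "y \<otimes> y \<otimes> b' \<otimes> a = a \<otimes> y"
  shows "b = b'"
proof -
  have "y \<otimes> y \<otimes> b \<otimes> a = y \<otimes> y \<otimes> b' \<otimes> a" using assms(5,6) by simp
  then show ?thesis using assms(1-4) by (simp add: m_assoc)
qed

section \<open>The residually nilpotent group\<close>

lemma residually_nilpotent_example:
  assumes p: "Factorial_Ring.prime p" "odd p" and l: "0 < l" and k: "0 < k"
  defines "F \<equiv> free_prod_cyclic (p ^ l) (p ^ k)"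
  shows "\<exists>G :: nat monoid. group G \<and> group_rank G = 2 \<and> \<not> G \<cong> F \<and>
           (\<forall>i\<ge>1. G Mod gamma G i \<cong> F Mod gamma F i) \<and> residually_nilpotent G"
proof -
  have p2: "2 \<le> p" using p(1) by (rule prime_ge_2_nat)
  interpret F: free_prod "p ^ l" "p ^ k"
    using l k p2 by unfold_locales (auto intro: order_trans[OF _ self_le_power])
  interpret FF: group F unfolding F_def by (rule F.group_F)
  note gen_in_F = F.gen_in_F[folded F_def] and gen_pow = F.gen_pow[folded F_def]
  define \<xi> where "\<xi> = [:0, 1 :: int:]"
  \<comment> \<open>The inverse of \<open>\<xi>\<close> modulo \<open>q\<close>; it evaluates at 2
    to the inverse 2^(p - 1) of 2 modulo 2^p - 1.\<close>
  define e where "e = \<xi> ^ (p - 1)"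
  define q where "q = \<xi> ^ p - 1"
  define I where "I = multiples q"
  define T where "T = tri_group I (\<xi> - 2)"
  have I: "ideal_set I" unfolding I_def by (rule ideal_multiples)
  have T: "group T" unfolding T_def by (rule tri_group[OF I])
  have \<xi>e_eq: "\<xi> * e = \<xi> ^ p" using p2 by (cases p) (simp_all add: e_def)
  have \<xi>p: "icong I (\<xi> ^ p) 1" by (simp add: I_def icong_multiples q_def)
  have \<xi>e: "icong I (\<xi> * e) 1" using \<xi>p by (simp add: \<xi>e_eq)
  define Q where "Q N = F Mod lcs F N" for N
  define c where "c N x = lcs F N #>\<^bsub>F\<^esub> x" for N x
  have c_hom: "group_hom F (Q N) (c N)" for N
    unfolding Q_def c_def by (intro FF.Mod_hom FF.lcs_normal)
  have Q: "group (Q N)" for N using c_hom group_hom.axioms(2) by blast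
  have "\<exists>y\<in>carrier F. inv\<^bsub>F\<^esub> (y \<otimes>\<^bsub>F\<^esub> y \<otimes>\<^bsub>F\<^esub> F.gen2 \<otimes>\<^bsub>F\<^esub> F.gen1) \<otimes>\<^bsub>F\<^esub> (F.gen1 \<otimes>\<^bsub>F\<^esub> y) \<in> lcs F N" for N
    by (rule FF.solve_mod_lcs[OF gen_in_F])
  \<comment> \<open>One approximate solution is chosen for each level; together they form the
    coordinates of a single element of the product.\<close>
  then obtain yF where yF: "yF N \<in> carrier F"
    "inv\<^bsub>F\<^esub> (yF N \<otimes>\<^bsub>F\<^esub> yF N \<otimes>\<^bsub>F\<^esub> F.gen2 \<otimes>\<^bsub>F\<^esub> F.gen1) \<otimes>\<^bsub>F\<^esub> (F.gen1 \<otimes>\<^bsub>F\<^esub> yF N) \<in> lcs F N" for N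
    by metis
  have rel_Q: "c N (yF N) \<otimes>\<^bsub>Q N\<^esub> c N (yF N) \<otimes>\<^bsub>Q N\<^esub> c N F.gen2 \<otimes>\<^bsub>Q N\<^esub> c N F.gen1 = c N F.gen1 \<otimes>\<^bsub>Q N\<^esub> c N (yF N)" for N
  proof -
    interpret c: group_hom F "Q N" "c N" by (rule c_hom)
    interpret L: normal "lcs F N" F by (rule FF.lcs_normal)
    define u where "u = yF N \<otimes>\<^bsub>F\<^esub> yF N \<otimes>\<^bsub>F\<^esub> F.gen2 \<otimes>\<^bsub>F\<^esub> F.gen1"
    define v where "v = F.gen1 \<otimes>\<^bsub>F\<^esub> yF N"
    have uv: "u \<in> carrier F" "v \<in> carrier F" using yF gen_in_F by (simp_all add: u_def v_def)
    have "c N (inv\<^bsub>F\<^esub> u \<otimes>\<^bsub>F\<^esub> v) = \<one>\<^bsub>Q N\<^esub>"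
      using FF.Mod_eq_one_iff[OF L.subgroup_axioms, of "inv\<^bsub>F\<^esub> u \<otimes>\<^bsub>F\<^esub> v"] yF(2)[of N] uv
      unfolding c_def Q_def u_def v_def by simp
    then have "inv\<^bsub>Q N\<^esub> (c N u) \<otimes>\<^bsub>Q N\<^esub> c N v = \<one>\<^bsub>Q N\<^esub>" using uv by (simp only: c.hom_mult c.hom_inv FF.inv_closed)
    then have "c N u = c N v"
      using uv by (metis c.H.inv_equality c.H.inv_inv c.H.inv_closed c.hom_closed)
    then show ?thesis unfolding u_def v_def using yF gen_in_F by (simp only: c.hom_mult FF.m_closed)
  qed
  define P where "P = product_group {..<p} (\<lambda>_. T) \<times>\<times> product_group UNIV Q"
  have P: "group P" unfolding P_def by (intro DirProd_group) (simp_all add: T Q)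
  define aP where "aP = ((\<lambda>i\<in>{..<p}. tri_rep I (tri_A \<xi> e i)), (\<lambda>N\<in>UNIV. c N F.gen1))"
  define yP where "yP = ((\<lambda>i\<in>{..<p}. tri_rep I (tri_Y \<xi> e i)), (\<lambda>N\<in>UNIV. c N (yF N)))"
  have c_closed: "c N x \<in> carrier (Q N)" if "x \<in> carrier F" for N x
    using group_hom.hom_closed[OF c_hom that] .
  have aP: "aP \<in> carrier P" unfolding aP_def P_def T_def
    using tri_A_carrier[OF I \<xi>e] c_closed[OF gen_in_F(1)] by auto
  have yP: "yP \<in> carrier P" unfolding yP_def P_def T_def
    using tri_Y_carrier[OF I \<xi>e] c_closed[OF yF(1)] by auto
  obtain G :: "nat monoid" and \<psi> a y where G: "group G" and \<psi>: "\<psi> \<in> hom G P" "inj_on \<psi> (carrier G)"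
    and a: "a \<in> carrier G" and y: "y \<in> carrier G" and \<psi>a: "\<psi> a = aP" and \<psi>y: "\<psi> y = yP"
    and gen: "generate G {a, y} = carrier G"
    by (rule countable_copy[OF P aP yP])
  interpret G: group G by fact
  define \<theta> where "\<theta> i g = fst (\<psi> g) i" for i g
  define \<pi> where "\<pi> N g = snd (\<psi> g) N" for N g
  have \<theta>: "\<theta> i \<in> hom G T" if "i < p" for i
    using hom_from_product(1)[OF \<psi>(1)[unfolded P_def], of i] that by (simp add: \<theta>_def[abs_def])
  have \<pi>: "\<pi> N \<in> hom G (Q N)" for N
    using hom_from_product(2)[OF \<psi>(1)[unfolded P_def]]
    by (auto simp: \<pi>_def[abs_def] hom_def Pi_iff)
  have \<theta>_hom: "group_hom G T (\<theta> i)" if "i < p" for i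
    using \<theta>[OF that] by (intro group_hom.intro group_hom_axioms.intro G T)
  have \<pi>_hom: "group_hom G (Q N) (\<pi> N)" for N
    using \<pi> by (intro group_hom.intro group_hom_axioms.intro G Q)
  have eqI: "g = h" if "g \<in> carrier G" "h \<in> carrier G" "\<And>i. i < p \<Longrightarrow> \<theta> i g = \<theta> i h" "\<And>N. \<pi> N g = \<pi> N h" for g h
    using product_eqI[OF \<psi>[unfolded P_def] that(1,2)] that(3,4) by (auto simp: \<theta>_def \<pi>_def)
  have \<theta>a: "\<theta> i a = tri_rep I (tri_A \<xi> e i)" and \<theta>y: "\<theta> i y = tri_rep I (tri_Y \<xi> e i)" if "i < p" for i
    using that by (simp_all add: \<theta>_def \<psi>a \<psi>y aP_def yP_def)
  have \<pi>a: "\<pi> N a = c N F.gen1" and \<pi>y: "\<pi> N y = c N (yF N)" for N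
    by (simp_all add: \<pi>_def \<psi>a \<psi>y aP_def yP_def)

  \<comment> \<open>The generators are \<open>a\<close> and \<open>y\<close>; the relation
    determines \<open>b\<close>, and by uniqueness its coordinates are \<open>tri_B\<close> and the
    cosets of \<open>gen2\<close>.\<close>
  define b where "b = inv\<^bsub>G\<^esub> (y \<otimes>\<^bsub>G\<^esub> y) \<otimes>\<^bsub>G\<^esub> (a \<otimes>\<^bsub>G\<^esub> y \<otimes>\<^bsub>G\<^esub> inv\<^bsub>G\<^esub> a)"
  have b: "b \<in> carrier G" using a y by (simp add: b_def)
  have rel: "y \<otimes>\<^bsub>G\<^esub> y \<otimes>\<^bsub>G\<^esub> b \<otimes>\<^bsub>G\<^esub> a = a \<otimes>\<^bsub>G\<^esub> y"
    using a y G.mult_inv_mult[of "y \<otimes>\<^bsub>G\<^esub> y" "a \<otimes>\<^bsub>G\<^esub> y \<otimes>\<^bsub>G\<^esub> inv\<^bsub>G\<^esub> a"] by (simp add: b_def) (simp add: G.m_assoc)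
  have \<theta>b: "\<theta> i b = tri_rep I (tri_B \<xi> e i)" if i: "i < p" for i
  proof -
    interpret h: group_hom G T "\<theta> i" by (rule \<theta>_hom[OF i])
    have B: "tri_rep I (tri_B \<xi> e i) \<in> carrier T" unfolding T_def by (rule tri_B_carrier[OF I \<xi>e])
    have "\<theta> i (y \<otimes>\<^bsub>G\<^esub> y \<otimes>\<^bsub>G\<^esub> b \<otimes>\<^bsub>G\<^esub> a) = \<theta> i (a \<otimes>\<^bsub>G\<^esub> y)" by (simp only: rel)
    then have r: "\<theta> i y \<otimes>\<^bsub>T\<^esub> \<theta> i y \<otimes>\<^bsub>T\<^esub> \<theta> i b \<otimes>\<^bsub>T\<^esub> \<theta> i a = \<theta> i a \<otimes>\<^bsub>T\<^esub> \<theta> i y"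
      using a y b by (simp only: h.hom_mult G.m_closed)
    have r': "\<theta> i y \<otimes>\<^bsub>T\<^esub> \<theta> i y \<otimes>\<^bsub>T\<^esub> tri_rep I (tri_B \<xi> e i) \<otimes>\<^bsub>T\<^esub> \<theta> i a = \<theta> i a \<otimes>\<^bsub>T\<^esub> \<theta> i y"
      unfolding \<theta>a[OF i] \<theta>y[OF i] T_def mult_tri_rep[OF I] tri_rep_eq_iff[OF I] by (rule tri_relation[OF I \<xi>e])
    show ?thesis
      by (rule h.H.solve_relation_unique[OF h.hom_closed[OF y] h.hom_closed[OF a] h.hom_closed[OF b] B r r'])
  qed
  have \<pi>b: "\<pi> N b = c N F.gen2" for N
  proof -
    interpret h: group_hom G "Q N" "\<pi> N" by (rule \<pi>_hom)
    have "\<pi> N (y \<otimes>\<^bsub>G\<^esub> y \<otimes>\<^bsub>G\<^esub> b \<otimes>\<^bsub>G\<^esub> a) = \<pi> N (a \<otimes>\<^bsub>G\<^esub> y)" by (simp only: rel)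
    then have r: "\<pi> N y \<otimes>\<^bsub>Q N\<^esub> \<pi> N y \<otimes>\<^bsub>Q N\<^esub> \<pi> N b \<otimes>\<^bsub>Q N\<^esub> \<pi> N a = \<pi> N a \<otimes>\<^bsub>Q N\<^esub> \<pi> N y"
      using a y b by (simp only: h.hom_mult G.m_closed)
    show ?thesis
      by (rule h.H.solve_relation_unique[OF h.hom_closed[OF y] h.hom_closed[OF a] h.hom_closed[OF b] c_closed[OF gen_in_F(2)] r])
        (simp only: \<pi>a \<pi>y rel_Q)
  qed
  \<comment> \<open>Torsion is tested by coordinates: in the matrix coordinates through an exponent
    \<open>p\<close> dividing \<open>n\<close>, in the nilpotent ones through an element of
    \<open>F\<close> with the same images.\<close>
  have pow_one: "g [^]\<^bsub>G\<^esub> (n::nat) = \<one>\<^bsub>G\<^esub>"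
    if g: "g \<in> carrier G" and \<theta>g: "\<And>i. i < p \<Longrightarrow> \<theta> i g [^]\<^bsub>T\<^esub> p = \<one>\<^bsub>T\<^esub>" and n: "p dvd n"
      and w: "w \<in> carrier F" "w [^]\<^bsub>F\<^esub> n = \<one>\<^bsub>F\<^esub>" "\<And>N. \<pi> N g = c N w" for g n w
  proof (rule eqI)
    fix i assume i: "i < p"
    interpret h: group_hom G T "\<theta> i" by (rule \<theta>_hom[OF i])
    show "\<theta> i (g [^]\<^bsub>G\<^esub> n) = \<theta> i \<one>\<^bsub>G\<^esub>"
      using h.H.pow_eq_one_dvd[OF h.hom_closed[OF g] \<theta>g[OF i] n] h.hom_nat_pow[OF g, of n] h.hom_one by metis
  next
    fix N
    interpret h: group_hom G "Q N" "\<pi> N" by (rule \<pi>_hom)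
    interpret c: group_hom F "Q N" "c N" by (rule c_hom)
    show "\<pi> N (g [^]\<^bsub>G\<^esub> n) = \<pi> N \<one>\<^bsub>G\<^esub>"
      using h.hom_nat_pow[OF g, of n] c.hom_nat_pow[OF w(1), of n] w(2,3) h.hom_one c.hom_one by metis
  qed (use g in auto)
  have a_pow: "a [^]\<^bsub>G\<^esub> (p ^ l) = \<one>\<^bsub>G\<^esub>"
    by (rule pow_one[OF a _ _ gen_in_F(1) gen_pow(1) \<pi>a])
      (use l in \<open>simp_all add: \<theta>a T_def tri_A_pow_eq_one[OF I \<xi>e \<xi>p]\<close>)
  have b_pow: "b [^]\<^bsub>G\<^esub> (p ^ k) = \<one>\<^bsub>G\<^esub>"
    by (rule pow_one[OF b _ _ gen_in_F(2) gen_pow(2) \<pi>b])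
      (use k in \<open>simp_all add: \<theta>b T_def tri_B_pow_eq_one[OF I \<xi>p]\<close>)

  define M where "M = (2 ^ p - 1 :: int)"
  \<comment> \<open>Evaluation at 2 sends \<open>q\<close> to \<open>M\<close> and the scaling
    factor \<open>\<xi> - 2\<close> to 0. The target product therefore has s = 0, and
    \<open>aff_part\<close> becomes multiplicative.\<close>
  define ev where "ev t = aff_part (case t of (d, e, x, y, z) \<Rightarrow> (poly d 2, poly e 2, poly x 2, poly y 2, poly z (2::int)))"
    for t :: "int poly tri"
  have ev_mult: "ev (tri_mult (\<xi> - 2) t u) = tri_mult 0 (ev t) (ev u)" for t u
    by (cases t; cases u) (simp add: ev_def \<xi>_def)
  have ev_one: "ev tri_one = tri_one" by (simp add: ev_def tri_one_def)
  have ev_cong: "tri_cong (multiples M) (ev t) (ev u)" if "tri_cong I t u" for t u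
  proof -
    have "M dvd poly f 2 - poly g 2" if dvd: "q dvd f - g" for f g
    proof -
      obtain v where "f - g = q * v" using dvd by (rule dvdE)
      then have "poly (f - g) 2 = poly (q * v) 2" by simp
      then show ?thesis by (simp add: q_def \<xi>_def M_def)
    qed
    then show ?thesis using that
      by (cases t; cases u) (auto simp: ev_def I_def icong_multiples)
  qed
  note ev_hom = tri_hom[OF I ideal_multiples ev_mult ev_one ev_cong]
  define \<kappa> where "\<kappa> i g = tri_rep (multiples M) (ev (\<theta> i g))" for i g
  have ev_A: "ev (tri_A \<xi> e i) = aff_A i" for i
    by (simp add: ev_def tri_A_def aff_A_def \<xi>_def poly_power)
  have ev_Y: "ev (tri_Y \<xi> e i) = aff_Y p i" for i
    by (simp add: ev_def tri_Y_def aff_Y_def \<xi>_def e_def poly_power)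
  interpret aff: aff_quotients G p a y \<kappa>
  proof
    fix i assume i: "i < p"
    show "\<kappa> i \<in> hom G (tri_group (multiples (2 ^ p - 1)) 0)"
      using Group.hom_compose[OF \<theta>[OF i, unfolded T_def] ev_hom(1)] by (simp add: comp_def \<kappa>_def[abs_def] M_def)
    show "\<kappa> i a = tri_rep (multiples (2 ^ p - 1)) (aff_A i)" "\<kappa> i y = tri_rep (multiples (2 ^ p - 1)) (aff_Y p i)"
      using ev_hom(2) by (simp_all only: \<kappa>_def \<theta>a[OF i] \<theta>y[OF i] ev_A ev_Y M_def)
  qed (fact p a y gen)+

  have "G Mod lcs G N \<cong> F Mod lcs F N" for N
    unfolding F_def
  proof (rule F.Mod_lcs_iso[OF G a b])
    interpret K: normal "lcs G N" G by (rule G.lcs_normal)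
    show "a [^]\<^bsub>G\<^esub> (p ^ l) \<in> lcs G N" "b [^]\<^bsub>G\<^esub> (p ^ k) \<in> lcs G N"
      unfolding a_pow b_pow by (rule K.one_closed)+
    show "\<pi> N \<in> hom G (F.\<F> Mod lcs F.\<F> N)" "\<pi> N a = lcs F.\<F> N #>\<^bsub>F.\<F>\<^esub> F.gen1" "\<pi> N b = lcs F.\<F> N #>\<^bsub>F.\<F>\<^esub> F.gen2"
      using \<pi>[of N] \<pi>a[of N] \<pi>b[of N] unfolding Q_def c_def F_def by simp_all
    fix g assume "g \<in> carrier G"
    then have g: "g \<in> generate G {a, y}" by (simp only: gen)
    have H: "subgroup (generate G {a, b}) G" using a b by (intro G.generate_is_subgroup) auto
    \<comment> \<open>The group is generated by \<open>a\<close> and \<open>y\<close>; modulo each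
      term of the series, \<open>y\<close> is a word in \<open>a\<close> and
      \<open>b\<close>.\<close>
    show "\<exists>h\<in>generate G {a, b}. inv\<^bsub>G\<^esub> h \<otimes>\<^bsub>G\<^esub> g \<in> lcs G N"
    proof (rule G.generate_mod_normal[OF K.normal_axioms H _ _ g])
      fix s assume "s \<in> {a, y}"
      moreover have "\<exists>h\<in>generate G {a, b}. inv\<^bsub>G\<^esub> h \<otimes>\<^bsub>G\<^esub> a \<in> lcs G N"
        using a K.one_closed by (intro bexI[of _ a]) (auto intro: generate.incl)
      ultimately show "\<exists>h\<in>generate G {a, b}. inv\<^bsub>G\<^esub> h \<otimes>\<^bsub>G\<^esub> s \<in> lcs G N"
        using G.root_in_generate_mod_lcs[OF a b y rel, of N] by blast
    qed (use a y in auto)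
  qed
  then have Mod: "\<forall>i\<ge>1. G Mod gamma G i \<cong> F Mod gamma F i" by (simp add: gamma_def)

  \<comment> \<open>The filtration by powers of \<open>\<xi> - 1\<close>; all matrices in the group
    are 1 modulo its first step, because the generators are.\<close>
  define J where "J = power_ideal (\<xi> - 1) q"
  have J: "ideal_set (J n)" for n unfolding J_def by (rule ideal_power_ideal)
  have IJ: "I \<subseteq> J n" for n unfolding I_def J_def by (rule multiples_subset_power_ideal)
  have J_mult: "\<alpha> * \<beta> \<in> J (Suc n)" if "\<alpha> \<in> J 1" "\<beta> \<in> J n" for \<alpha> \<beta> n
    using that unfolding J_def by (rule power_ideal_mult)
  have dvd_pow: "\<xi> - 1 dvd \<xi> ^ n - 1" for n
    by (simp add: power_diff_1_eq)
  have J1: "icong (J 1) (\<xi> ^ n) 1" "icong (J 1) ((\<xi> - 1) * u) 0" "icong (J 1) (\<xi> - 1) 0" for n u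
    unfolding icong_def J_def by (rule dvd_in_power_ideal; simp add: dvd_pow)+
  have J1': "icong (J 1) \<xi> 1" using J1(1)[of 1] by simp
  have gens_J1: "tri_cong (J 1) (\<theta> i g) tri_one" if i: "i < p" and g: "g \<in> {a, y}" for i g
  proof -
    have *: "tri_cong (J 1) (tri_rep I t) tri_one" if "tri_cong (J 1) t tri_one" for t
    proof -
      have "tri_cong I (tri_rep I t) t" by (rule tri_cong_sym[OF I tri_rep_cong[OF I]])
      then have "tri_cong (J 1) (tri_rep I t) t"
        using IJ by (cases t) (auto simp: icong_def simp del: One_nat_def)
      then show ?thesis using that tri_cong_trans[OF J] by blast
    qed
    have A: "tri_cong (J 1) (tri_A \<xi> e i) tri_one" and Y: "tri_cong (J 1) (tri_Y \<xi> e i) tri_one"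
      using J1 J1' icong_refl[OF J] by (auto simp: tri_A_def tri_Y_def tri_one_def e_def simp del: One_nat_def)
    from g consider "g = a" | "g = y" by blast
    then show ?thesis
    proof cases
      case 1
      show ?thesis unfolding 1 \<theta>a[OF i] by (rule *[OF A])
    next
      case 2
      show ?thesis unfolding 2 \<theta>y[OF i] by (rule *[OF Y])
    qed
  qed
  have "residually_nilpotent G"
    unfolding residually_nilpotent_def
  proof
    show "{\<one>\<^bsub>G\<^esub>} \<subseteq> (\<Inter>i\<in>{1..}. gamma G i)"
      using subgroup.one_closed[OF normal_imp_subgroup[OF G.lcs_normal]] by (simp add: gamma_def)
    show "(\<Inter>i\<in>{1..}. gamma G i) \<subseteq> {\<one>\<^bsub>G\<^esub>}"
    proof
      fix g assume g': "g \<in> (\<Inter>i\<in>{1..}. gamma G i)"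
      have g: "g \<in> lcs G n" for n
        using INT_D[OF g', of "Suc n"] by (simp add: gamma_def)
      have gG: "g \<in> carrier G" using g[of 0] by simp
      have "g = \<one>\<^bsub>G\<^esub>"
      proof (rule eqI[OF gG G.one_closed])
        fix i assume i: "i < p"
        interpret h: group_hom G T "\<theta> i" by (rule \<theta>_hom[OF i])
        have "tri_cong (J 1) (\<theta> i h) tri_one" if "h \<in> carrier G" for h
          using tri_cong_generate[where S = "{a, y}" and g = h, OF G I J IJ \<theta>[OF i, unfolded T_def] _ gens_J1[OF i]]
            that a y gen by auto
        then have "tri_cong (J (Suc n)) (\<theta> i g) tri_one" for n
          using lcs_tri_filtration[where J = J, OF G I \<theta>[OF i, unfolded T_def] J IJ J_mult _ g] by blast
        then have **: "tri_cong (J n) (\<theta> i g) tri_one" if "n > 0" for n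
          using that by (cases n) auto
        \<comment> \<open>The filtration argument provides only positive exponents; for n = 0 the
          power ideal is the whole ring.\<close>
        have inter: "f \<in> I" if "\<And>n. n > 0 \<Longrightarrow> f \<in> J n" for f
          unfolding I_def q_def \<xi>_def
        proof (rule power_ideals_Inter[OF p])
          fix n
          show "f \<in> power_ideal ([:0, 1:] - 1) ([:0, 1:] ^ p - 1) n"
          proof (cases "n = 0")
            case True
            have "f = f * ([:0, 1:] - 1) ^ n + 0 * ([:0, 1:] ^ p - 1)" by (simp add: True)
            then show ?thesis unfolding power_ideal_def by blast
          next
            case False
            then show ?thesis using that[of n] by (simp add: J_def q_def \<xi>_def)
          qed
        qed
        have "tri_cong I (\<theta> i g) tri_one"
          using ** inter by (cases "\<theta> i g") (auto simp: tri_one_def icong_def)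
        then have "tri_rep I (\<theta> i g) = \<one>\<^bsub>T\<^esub>" by (simp add: T_def one_tri_group tri_rep_eq_iff[OF I])
        moreover have "tri_rep I (\<theta> i g) = \<theta> i g"
          using h.hom_closed[OF gG] unfolding T_def by (rule carrier_tri_group_rep[OF I])
        ultimately show "\<theta> i g = \<theta> i \<one>\<^bsub>G\<^esub>" by simp
      next
        fix N
        interpret h: group_hom G "Q N" "\<pi> N" by (rule \<pi>_hom)
        \<comment> \<open>In coordinate \<open>N\<close> membership in \<open>lcs G N\<close>
          already suffices, since the series of \<open>Q N\<close> is trivial at index
          \<open>N\<close>.\<close>
        have "\<pi> N g \<in> lcs (Q N) N" using h.lcs_image[of N] g[of N] by blast
        then show "\<pi> N g = \<pi> N \<one>\<^bsub>G\<^esub>" using FF.lcs_Mod[of N] unfolding Q_def[symmetric] by simp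
      qed
      then show "g \<in> {\<one>\<^bsub>G\<^esub>}" by simp
    qed
  qed
  then show ?thesis
    using G aff.rank aff.not_iso_free_prod[OF l k] Mod unfolding F_def by blast
qed

section \<open>The group that is not residually nilpotent\<close>

lemma not_residually_nilpotent_example:
  assumes p: "Factorial_Ring.prime p" "odd p" and l: "0 < l" and k: "0 < k"
  defines "F \<equiv> free_prod_cyclic (p ^ l) (p ^ k)"
  shows "\<exists>G :: nat monoid. group G \<and> group_rank G = 2 \<and> \<not> G \<cong> F \<and>
           (\<forall>i\<ge>1. G Mod gamma G i \<cong> F Mod gamma F i) \<and> \<not> residually_nilpotent G"
proof -
  have p2: "2 \<le> p" using p(1) by (rule prime_ge_2_nat)
  interpret F: free_prod "p ^ l" "p ^ k"
    using l k p2 by unfold_locales (auto intro: order_trans[OF _ self_le_power])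
  interpret FF: group F unfolding F_def by (rule F.group_F)
  note gen_in_F = F.gen_in_F[folded F_def] and gen_pow = F.gen_pow[folded F_def]
  define M where "M = (2 ^ p - 1 :: int)"
  define I where "I = multiples M"
  define T where "T = tri_group I 0"
  have I: "ideal_set I" unfolding I_def by (rule ideal_multiples)
  have T: "group T" unfolding T_def by (rule tri_group[OF I])
  interpret T: group T by (rule T)
  have two_p: "2 * 2 ^ (p - 1) = (2 ^ p :: int)" using p2 by (cases p) simp_all
  have e: "icong I (2 * 2 ^ (p - 1)) 1" "icong I (2 ^ (p - 1) * 2) 1" "icong I (2 ^ p) 1"
    using two_p by (simp_all add: I_def icong_multiples M_def mult.commute)
  have oo: "icong I (1 * 1) 1" using icong_refl[OF I] by simp
  have A: "tri_rep I (aff_A i) \<in> carrier T" for i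
  proof -
    have "icong I (2 ^ i * (2 ^ (p - 1)) ^ i) 1"
      using icong_power[OF I e(1), of i] by (simp only: power_mult_distrib power_one)
    then show ?thesis unfolding aff_A_def T_def
      using tri_rep_in_carrier[OF I e(1) oo] tri_rep_in_carrier[OF I _ oo] by auto
  qed
  have Y: "tri_rep I (aff_Y p i) \<in> carrier T" for i
    unfolding aff_Y_def T_def
    using tri_rep_in_carrier[OF I e(2) oo] tri_rep_in_carrier[OF I oo oo] by auto
  have A_pow: "tri_rep I (aff_A i) [^]\<^bsub>T\<^esub> p = \<one>\<^bsub>T\<^esub>" for i
  proof -
    have "tri_pow 0 (d, 1, 0, 0, 0) j = (d ^ j, 1, 0, 0, 0 :: int)" for d j
      by (induction j) (simp_all add: tri_one_def mult.commute)
    moreover have "icong I ((2 ^ i) ^ p) 1"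
      using icong_power[OF I e(3), of i] by (simp add: power_mult[symmetric] mult.commute)
    ultimately show ?thesis
      using e(3) by (simp add: T_def pow_tri_rep[OF I] one_tri_group aff_A_def tri_one_def rep_eq_iff[OF I] del: tri_rep.simps)
        (simp add: rep_eq_iff[OF I])
  qed
  have Y_pow: "tri_rep I (aff_Y p i) [^]\<^bsub>T\<^esub> p = \<one>\<^bsub>T\<^esub>" if "0 < i" for i
  proof -
    define d where "d = (2 ^ (p - 1) :: int)"
    have dp: "icong I (d ^ p) 1"
      using icong_power[OF I e(3), of "p - 1"] by (simp add: d_def power_mult[symmetric] mult.commute)
    \<comment> \<open>Since 2 d is 1 modulo \<open>M\<close>, the translation part 1 equals 2 - 2 d.
      The affine map v \<mapsto> d v + 1 then visibly fixes 2, which gives the closed form of its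
      powers.\<close>
    have "icong I 1 (2 - 2 * d)" using two_p by (simp add: I_def icong_multiples M_def d_def)
    then have "tri_cong I (aff_Y p i) (d, 1, 0, 0, 2 - 2 * d)"
      using that by (simp add: aff_Y_def d_def icong_refl[OF I])
    then have "tri_rep I (aff_Y p i) = tri_rep I (d, 1, 0, 0, 2 - 2 * d)"
      by (simp only: tri_rep_eq_iff[OF I])
    moreover have "tri_pow 0 (d, 1, 0, 0, 2 - 2 * d) j = (d ^ j, 1, 0, 0, 2 - 2 * d ^ j)" for j
      by (induction j) (simp_all add: tri_one_def algebra_simps)
    moreover have "icong I (2 - 2 * d ^ p) 0"
      using ideal_setD(3)[OF I, of "d ^ p - 1" "- 2"] dp by (simp add: icong_def algebra_simps)
    ultimately show ?thesis
      using dp by (simp only: T_def pow_tri_rep[OF I] one_tri_group) (simp add: tri_one_def rep_eq_iff[OF I])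
  qed
  \<comment> \<open>For i = 0 the second generator is a translation, so its p^k-th power survives
    while it dies in all other coordinates.\<close>
  have Y0_pow: "tri_rep I (aff_Y p 0) [^]\<^bsub>T\<^esub> n = tri_rep I (1, 1, 0, 0, - 9 * int n)" for n
  proof -
    have "tri_pow 0 (aff_Y p 0) n = (1, 1, 0, 0, - 9 * int n)"
      by (induction n) (simp_all add: aff_Y_def tri_one_def algebra_simps)
    then show ?thesis by (simp only: T_def pow_tri_rep[OF I])
  qed

  \<comment> \<open>Here \<open>F\<close> itself is a coordinate, and \<open>y\<close> maps to
    \<open>gen2\<close> directly, so \<open>y\<close> plays the role of \<open>b\<close>.\<close>
  define P where "P = product_group {..<p} (\<lambda>_. T) \<times>\<times> F"
  have P: "group P" unfolding P_def by (intro DirProd_group FF.is_group) (simp add: T)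
  define aP where "aP = ((\<lambda>i\<in>{..<p}. tri_rep I (aff_A i)), F.gen1)"
  define yP where "yP = ((\<lambda>i\<in>{..<p}. tri_rep I (aff_Y p i)), F.gen2)"
  have aP: "aP \<in> carrier P" unfolding aP_def P_def using A gen_in_F by auto
  have yP: "yP \<in> carrier P" unfolding yP_def P_def using Y gen_in_F by auto
  obtain G :: "nat monoid" and \<psi> a y where G: "group G" and \<psi>: "\<psi> \<in> hom G P" "inj_on \<psi> (carrier G)"
    and a: "a \<in> carrier G" and y: "y \<in> carrier G" and \<psi>a: "\<psi> a = aP" and \<psi>y: "\<psi> y = yP"
    and gen: "generate G {a, y} = carrier G"
    by (rule countable_copy[OF P aP yP])
  interpret G: group G by fact
  define \<kappa> where "\<kappa> i g = fst (\<psi> g) i" for i g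
  define \<pi> where "\<pi> g = snd (\<psi> g)" for g
  have \<kappa>: "\<kappa> i \<in> hom G T" if "i < p" for i
    using hom_from_product(1)[OF \<psi>(1)[unfolded P_def], of i] that by (simp add: \<kappa>_def[abs_def])
  have \<pi>: "\<pi> \<in> hom G F"
    using hom_from_product(2)[OF \<psi>(1)[unfolded P_def]] by (simp add: \<pi>_def[abs_def])
  interpret \<pi>: group_hom G F \<pi>
    by (intro group_hom.intro group_hom_axioms.intro G FF.is_group \<pi>)
  have \<kappa>_hom: "group_hom G T (\<kappa> i)" if "i < p" for i
    using \<kappa>[OF that] by (intro group_hom.intro group_hom_axioms.intro G T)
  have eqI: "g = h" if "g \<in> carrier G" "h \<in> carrier G" "\<And>i. i < p \<Longrightarrow> \<kappa> i g = \<kappa> i h" "\<pi> g = \<pi> h" for g h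
    using product_eqI[OF \<psi>[unfolded P_def] that(1,2)] that(3,4) by (auto simp: \<kappa>_def \<pi>_def)
  have \<kappa>a: "\<kappa> i a = tri_rep I (aff_A i)" and \<kappa>y: "\<kappa> i y = tri_rep I (aff_Y p i)" if "i < p" for i
    using that by (simp_all add: \<kappa>_def \<psi>a \<psi>y aP_def yP_def)
  have \<pi>a: "\<pi> a = F.gen1" and \<pi>y: "\<pi> y = F.gen2"
    by (simp_all add: \<pi>_def \<psi>a \<psi>y aP_def yP_def)
  interpret aff: aff_quotients G p a y \<kappa>
    by unfold_locales (use p a y gen \<kappa> \<kappa>a \<kappa>y in \<open>simp_all add: T_def I_def M_def\<close>)

  have a_pow: "a [^]\<^bsub>G\<^esub> (p ^ l) = \<one>\<^bsub>G\<^esub>"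
  proof (rule eqI)
    fix i assume i: "i < p"
    interpret h: group_hom G T "\<kappa> i" by (rule \<kappa>_hom[OF i])
    have "\<kappa> i a [^]\<^bsub>T\<^esub> (p ^ l) = \<one>\<^bsub>T\<^esub>"
      unfolding \<kappa>a[OF i] by (rule T.pow_eq_one_dvd[OF A A_pow dvd_power]) (use l in blast)
    then show "\<kappa> i (a [^]\<^bsub>G\<^esub> (p ^ l)) = \<kappa> i \<one>\<^bsub>G\<^esub>"
      unfolding h.hom_nat_pow[OF a] h.hom_one .
  next
    show "\<pi> (a [^]\<^bsub>G\<^esub> (p ^ l)) = \<pi> \<one>\<^bsub>G\<^esub>"
      unfolding \<pi>.hom_nat_pow[OF a] \<pi>.hom_one \<pi>a by (rule gen_pow(1))
  qed (use a in auto)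

  define c where "c = y [^]\<^bsub>G\<^esub> (p ^ k)"
  have c: "c \<in> carrier G" using y by (simp add: c_def)
  have \<pi>c: "\<pi> c = \<one>\<^bsub>F\<^esub>"
    unfolding c_def \<pi>.hom_nat_pow[OF y] \<pi>y by (rule gen_pow(2))
  have \<kappa>c: "\<kappa> i c = \<one>\<^bsub>T\<^esub>" if i: "0 < i" "i < p" for i
  proof -
    interpret h: group_hom G T "\<kappa> i" by (rule \<kappa>_hom[OF i(2)])
    have "\<kappa> i y [^]\<^bsub>T\<^esub> (p ^ k) = \<one>\<^bsub>T\<^esub>"
      unfolding \<kappa>y[OF i(2)] by (rule T.pow_eq_one_dvd[OF Y Y_pow[OF i(1)] dvd_power]) (use k in blast)
    then show ?thesis unfolding c_def h.hom_nat_pow[OF y] .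
  qed
  have \<kappa>0c: "\<kappa> 0 c = tri_rep I (1, 1, 0, 0, - 9 * int (p ^ k))"
  proof -
    have p0: "0 < p" using p2 by simp
    interpret h: group_hom G T "\<kappa> 0" by (rule \<kappa>_hom[OF p0])
    show ?thesis unfolding c_def h.hom_nat_pow[OF y] \<kappa>y[OF p0] by (rule Y0_pow)
  qed
  \<comment> \<open>Only coordinate 0 of \<open>c\<close> is nontrivial. There \<open>c\<close> is a
    translation and \<open>a\<close> acts as doubling, so conjugating \<open>c\<close> by
    \<open>a\<close> squares it.\<close>
  have ac: "a \<otimes>\<^bsub>G\<^esub> c = c \<otimes>\<^bsub>G\<^esub> c \<otimes>\<^bsub>G\<^esub> a"
  proof (rule eqI)
    fix i assume i: "i < p"
    interpret h: group_hom G T "\<kappa> i" by (rule \<kappa>_hom[OF i])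
    have "\<kappa> i a \<otimes>\<^bsub>T\<^esub> \<kappa> i c = \<kappa> i c \<otimes>\<^bsub>T\<^esub> \<kappa> i c \<otimes>\<^bsub>T\<^esub> \<kappa> i a"
    proof (cases "i = 0")
      case True
      show ?thesis
        unfolding True \<kappa>0c \<kappa>a[OF i, unfolded True] T_def mult_tri_rep[OF I] by (simp add: aff_A_def)
    next
      case False
      then show ?thesis using \<kappa>c[of i] i h.hom_closed[OF a] by simp
    qed
    then show "\<kappa> i (a \<otimes>\<^bsub>G\<^esub> c) = \<kappa> i (c \<otimes>\<^bsub>G\<^esub> c \<otimes>\<^bsub>G\<^esub> a)"
      using a c by simp
  next
    show "\<pi> (a \<otimes>\<^bsub>G\<^esub> c) = \<pi> (c \<otimes>\<^bsub>G\<^esub> c \<otimes>\<^bsub>G\<^esub> a)"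
      using a c by (simp add: \<pi>c)
  qed (use a c in auto)
  \<comment> \<open>Thus \<open>c\<close> is its own commutator with \<open>a\<close>, and by
    induction it never leaves the lower central series.\<close>
  have c_comm: "a \<otimes>\<^bsub>G\<^esub> c \<otimes>\<^bsub>G\<^esub> inv\<^bsub>G\<^esub> a \<otimes>\<^bsub>G\<^esub> inv\<^bsub>G\<^esub> c = c"
    unfolding ac using a c by (simp add: G.m_assoc)
  have c_lcs: "c \<in> lcs G n" for n
  proof (induction n)
    case (Suc n)
    from G.lcs_commutator[OF a this] show ?case unfolding c_comm .
  qed (use c in simp)
  have c_ne: "c \<noteq> \<one>\<^bsub>G\<^esub>"
  proof
    assume "c = \<one>\<^bsub>G\<^esub>"
    moreover have p0: "0 < p" using p2 by simp
    ultimately have "tri_rep I (1, 1, 0, 0, - 9 * int (p ^ k)) = tri_rep I tri_one"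
      using \<kappa>0c group_hom.hom_one[OF \<kappa>_hom[OF p0]] by (simp add: T_def one_tri_group del: tri_rep.simps)
    then have "M dvd - 9 * int (p ^ k)"
      by (simp add: rep_eq_iff[OF I] tri_one_def) (simp add: I_def icong_multiples)
    then have "M dvd int p ^ k * 9" by (simp add: mult.commute)
    then have "M dvd 9"
      using coprime_two_power_minus_one[OF p, of k] by (simp add: M_def coprime_dvd_mult_right_iff)
    then show False using aff.M_not_dvd_9 by (simp add: M_def)
  qed
  have "c \<in> (\<Inter>i\<in>{1..}. gamma G i)" using c_lcs by (auto simp: gamma_def)
  then have "\<not> residually_nilpotent G" using c_ne by (auto simp: residually_nilpotent_def)
  moreover have "G Mod lcs G N \<cong> F Mod lcs F N" for N
    unfolding F_def
  proof (rule F.Mod_lcs_iso[OF G a y])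
    interpret K: normal "lcs G N" G by (rule G.lcs_normal)
    show "a [^]\<^bsub>G\<^esub> (p ^ l) \<in> lcs G N" unfolding a_pow by (rule K.one_closed)
    \<comment> \<open>In \<open>G\<close> this power is the nontrivial element \<open>c\<close>, but
      it lies in every term of the series, which is all the comparison of quotients asks
      for.\<close>
    show "y [^]\<^bsub>G\<^esub> (p ^ k) \<in> lcs G N" using c_lcs by (simp add: c_def)
    show "(\<lambda>g. lcs F.\<F> N #>\<^bsub>F.\<F>\<^esub> \<pi> g) \<in> hom G (F.\<F> Mod lcs F.\<F> N)"
      using Group.hom_compose[OF \<pi> group_hom.homh[OF FF.Mod_hom[OF FF.lcs_normal[of N]]]]
      by (simp add: comp_def F_def)
    fix g assume g: "g \<in> carrier G"
    then show "\<exists>h\<in>generate G {a, y}. inv\<^bsub>G\<^esub> h \<otimes>\<^bsub>G\<^esub> g \<in> lcs G N"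
      unfolding gen using K.one_closed by (intro bexI[of _ g]) auto
  qed (simp_all add: \<pi>a \<pi>y)
  ultimately show ?thesis
    using G aff.rank aff.not_iso_free_prod[OF l k] unfolding F_def gamma_def by blast
qed

theorem mainTheorem16:
  fixes p l k :: nat
  assumes "Factorial_Ring.prime p" and "odd p" and "0 < l" and "0 < k"
  shows "\<exists>(G1 :: nat monoid) (G2 :: nat monoid).
           group G1 \<and> group G2 \<and>
           group_rank G1 = 2 \<and> group_rank G2 = 2 \<and>
           \<not> (G1 \<cong> free_prod_cyclic (p ^ l) (p ^ k)) \<and>
           \<not> (G2 \<cong> free_prod_cyclic (p ^ l) (p ^ k)) \<and>
           (\<forall>i\<ge>1.
              G1 Mod gamma G1 i \<cong>
                free_prod_cyclic (p ^ l) (p ^ k) Mod gamma (free_prod_cyclic (p ^ l) (p ^ k)) i \<and>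
              G2 Mod gamma G2 i \<cong>
                free_prod_cyclic (p ^ l) (p ^ k) Mod gamma (free_prod_cyclic (p ^ l) (p ^ k)) i) \<and>
           residually_nilpotent G1 \<and> \<not> residually_nilpotent G2"
  using residually_nilpotent_example[OF assms] not_residually_nilpotent_example[OF assms] by blast

end
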